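(* For the relaxed regularized NMPC problem and the matrices $D^*$, $\bar D^*$, $\tilde D^*$, $L$, $U$ defined in the context, the convergence of the upper-layer Jacobi method $S^{k+1}=S^k-\alpha^{\max}(D^k)^{-1}\mathcal{K}^k$ is described as follows. (i) Let the regularization parameter $\gamma$ be chosen to be nonzero. There exists $T_0>0$ such that $\rho\big((D^* )^{-1}(L+U)\big)<1$ holds for any prediction horizon $T<T_0$. (ii) There exists $\epsilon>0$ such that $\rho\big((D^* )^{-1}(L+U)\big)<1$ holds for any $\tilde D_i^*$ satisfying $\|\tilde D_i^*\|<\epsilon\|\bar D_i^*\|$, $i\in\{1,\dots,N\}$.
   Context: Notation: $\rho(P)$ is the spectral radius of a square matrix $P$; $\|\cdot\|$ is the Euclidean norm for vectors and the Frobenius norm for matrices. For a differentiable $f:\mathbb{R}^n\to\mathbb{R}^m$, $\nabla_v f\in\mathbb{R}^{m\times n}$ is the Jacobian matrix. $v_{(j)}$ is the $j$-th component of a vector $v$. A superscript $k$ denotes the value at the $k$-th iteration. Problem: Let $\mathbb{U}=[\underline u,\bar u]\subset\mathbb{R}^{n_u}$ and $\mathbb{X}=[\underline x,\bar x]\subset\mathbb{R}^{n_x}$ be boxes with given bounds, let $f(u,x)\in\mathbb{R}^{n_x}$ be the dynamics ($\dot x=f(u,x)$), and let $l_i(u,x)\in\mathbb{R}$ be the stage costs ($i=1,\dots,N$); $f$ and $l_i$ are twice differentiable. Let $G(u,x)\ge 0$ be the vector inequality stacking all the constraints $u\in\mathbb{U}$, $x\in\mathbb{X}$. Let $T>0$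 be the prediction horizon, $N$ the number of stages, $h:=T/N$ the temporal step size, $\gamma\ge 0$ the regularization parameter, $\tau>0$ the barrier parameter, $\tilde u_i^*$ given regularization references, $\bar x_0$ the given initial state, and $\Phi(u,x):=-\tau\sum_j\ln G_{(j)}(u,x)$. The relaxed regularized NMPC (nonlinear model predictive control) problem is $$\min_{u_1,\dots,u_N,\,x_0,\dots,x_N}\ \sum_{i=1}^N\Big(h\,l_i(u_i,x_i)+h\,\Phi(u_i,x_i)+\tfrac{\gamma}{2}\|u_i-\tilde u_i^*\|^2\Big)\quad\text{s.t. } x_0=\bar x_0,\ x_i=x_{i-1}+hf(u_i,x_i),\ i=1,\dots,N.$$ KKT equations: With costates (Lagrange multipliers of the state equations) $\lambda_i\in\mathbb{R}^{n_x}$, $s_i=(x_i,u_i,\lambda_i)$, $S=(s_1,\dots,s_N)$ and Hamiltonian $\mathcal{H}_i(s)=l_i(u,x)+\Phi(u,x)+\lambda^Tf(u,x)$, define $$\mathcal{K}_i(x_{i-1},s_i,\lambda_{i+1})=\begin{bmatrix}x_{i-1}-x_i+hf(u_i,x_i)\\ h\nabla_u\mathcal{H}_i(s_i)^T+\gamma(u_i-\tilde u_i^* )\\ \lambda_{i+1}-\lambda_i+h\nabla_x\mathcal{H}_i(s_i)^T\end{bmatrix},\qquad x_0=\bar x_0,\ \lambda_{N+1}=0.$$ $S^*=(s_1^*,\dots,s_N^* )$ denotes a solution of the KKT equations $\mathcal{K}_i(x_{i-1}^*,s_i^*,\lambda_{i+1}^* )=0$, $i=1,\dots,N$, with $G(u_i^*,x_i^*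 )>0$ for all $i$. A superscript $*$ on a function means evaluation at $S^*$. Upper-layer Jacobi method: Let $\mathcal{K}_i^k=\mathcal{K}_i(x_{i-1}^k,s_i^k,\lambda_{i+1}^k)$, $\mathcal{K}^k=(\mathcal{K}_1^k,\dots,\mathcal{K}_N^k)$, $D_i^k=\nabla_{s_i}\mathcal{K}_i^k$, and let $D^k$ be the block-diagonal matrix with diagonal blocks $D_1^k,\dots,D_N^k$. The method is the iteration $S^{k+1}=S^k-\alpha^{\max}(D^k)^{-1}\mathcal{K}^k$ for solving the KKT equations, where $S^0$ satisfies $G(u_i^0,x_i^0)>0$ for all $i$ and $\alpha^{\max}$ is the largest step size in $(0,1]$ such that $G(u_i^{k+1},x_i^{k+1})\ge 0.005\,G(u_i^k,x_i^k)$ for all $i\in\{1,\dots,N\}$. Matrices: $D_i^*:=\nabla_{s_i}\mathcal{K}_i^*=\bar D_i^*+h\tilde D_i^*$ with $$\bar D_i^*=\begin{bmatrix}h\nabla_xf_i^*-I&0&0\\ h\nabla^2_{ux}\mathcal{H}_i^*&h\nabla^2_{uu}\mathcal{H}_i^*+\gamma I&0\\ h\nabla^2_{xx}\mathcal{H}_i^*&h\nabla^2_{xu}\mathcal{H}_i^*&h(\nabla_xf_i^* )^T-I\end{bmatrix},\qquad \tilde D_i^*=\begin{bmatrix}0&\nabla_uf_i^*&0\\0&0&(\nabla_uf_i^* )^T\\0&0&0\end{bmatrix},$$ where $f_i^*=f(u_i^*,x_i^* )$ and $\mathcal{H}_i^*=\mathcal{H}_i(s_i^* )$. $D^*$, $\bar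 D^*$, $\tilde D^*$ are the block-diagonal matrices with diagonal blocks $D_i^*$, $\bar D_i^*$, $\tilde D_i^*$ ($i=1,\dots,N$) respectively, so $D^*=\bar D^*+h\tilde D^*$. Let $$M_L=\begin{bmatrix}I_{n_x}&0&0\\0&0&0\\0&0&0\end{bmatrix},\qquad M_U=\begin{bmatrix}0&0&0\\0&0&0\\0&0&I_{n_x}\end{bmatrix}$$ (size $(2n_x+n_u)\times(2n_x+n_u)$). $L$ is the $N\times N$ block matrix with $M_L$ in every block position $(i,i-1)$, $i=2,\dots,N$, and zeros elsewhere; $U$ is the $N\times N$ block matrix with $M_U$ in every block position $(i,i+1)$, $i=1,\dots,N-1$, and zeros elsewhere.
   Formalization: In (i), f and l_i are assumed twice continuously differentiable and the initial state is assumed in the interior of the box X; in (ii), the blocks D̄_i* are assumed invertible. Without these the claims can fail, as D* may be singular. *)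

theory Defs
  imports "HOL-Analysis.Analysis"
begin

section \<open>Calculus\<close>

text \<open>The gradient as a column vector, i.e. the transposed \<open>1 \<times> n\<close> Jacobian.\<close>

definition grad :: "(real^'a::finite \<Rightarrow> real) \<Rightarrow> real^'a \<Rightarrow> real^'a" where
  "grad g v = (\<chi> j. frechet_derivative g (at v) (axis j 1))"

definition twice_differentiable ::
    "('a::real_normed_vector \<Rightarrow> 'b::real_normed_vector) \<Rightarrow> bool" where
  "twice_differentiable F \<longleftrightarrow>
     (\<exists>F' :: 'a \<Rightarrow> 'a \<Rightarrow>\<^sub>L 'b.
        (\<forall>z. (F has_derivative blinfun_apply (F' z)) (at z)) \<and>
        (\<forall>z. F' differentiable (at z)))"

definition twice_continuously_differentiable ::
    "('a::real_normed_vector \<Rightarrow> 'b::real_normed_vector) \<Rightarrow> bool" where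
  "twice_continuously_differentiable F \<longleftrightarrow>
     (\<exists>(F' :: 'a \<Rightarrow> 'a \<Rightarrow>\<^sub>L 'b) (F'' :: 'a \<Rightarrow> 'a \<Rightarrow>\<^sub>L ('a \<Rightarrow>\<^sub>L 'b)).
        (\<forall>z. (F has_derivative blinfun_apply (F' z)) (at z)) \<and>
        (\<forall>z. (F' has_derivative blinfun_apply (F'' z)) (at z)) \<and>
        continuous_on UNIV F'')"


section \<open>Matrices\<close>

definition spectral_radius :: "real^'n::finite^'n \<Rightarrow> real" where
  "spectral_radius A =
     Max {cmod \<mu> |\<mu>. \<exists>v :: complex^'n. v \<noteq> 0 \<and>
       (\<chi> i j. complex_of_real (A $ i $ j)) *v v = \<mu> *s v}"

text \<open>Vectors and square matrices partitioned into the three blocks of sizes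
  \<open>n\<^sub>x\<close>, \<open>n\<^sub>u\<close>, \<open>n\<^sub>x\<close>, in the order state, input, costate.\<close>

definition stack3 :: "real^'x::finite \<Rightarrow> real^'u::finite \<Rightarrow> real^'x \<Rightarrow> real^('x + 'u + 'x)" where
  "stack3 x u lam = (\<chi> k. case k of Inl a \<Rightarrow> x $ a
     | Inr (Inl b) \<Rightarrow> u $ b
     | Inr (Inr c) \<Rightarrow> lam $ c)"

definition x_of :: "real^('x::finite + 'u::finite + 'x) \<Rightarrow> real^'x" where
  "x_of s = (\<chi> a. s $ Inl a)"

definition u_of :: "real^('x::finite + 'u::finite + 'x) \<Rightarrow> real^'u" where
  "u_of s = (\<chi> b. s $ Inr (Inl b))"

definition lam_of :: "real^('x::finite + 'u::finite + 'x) \<Rightarrow> real^'x" where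
  "lam_of s = (\<chi> c. s $ Inr (Inr c))"

definition block3 ::
    "real^'x::finite^'x \<Rightarrow> real^'u::finite^'x \<Rightarrow> real^'x^'x \<Rightarrow>
     real^'x^'u \<Rightarrow> real^'u^'u \<Rightarrow> real^'x^'u \<Rightarrow>
     real^'x^'x \<Rightarrow> real^'u^'x \<Rightarrow> real^'x^'x \<Rightarrow>
     real^('x + 'u + 'x)^('x + 'u + 'x)" where
  "block3 A11 A12 A13 A21 A22 A23 A31 A32 A33 = (\<chi> p q.
     case p of
       Inl a \<Rightarrow> stack3 (A11 $ a) (A12 $ a) (A13 $ a) $ q
     | Inr (Inl b) \<Rightarrow> stack3 (A21 $ b) (A22 $ b) (A23 $ b) $ q
     | Inr (Inr c) \<Rightarrow> stack3 (A31 $ c) (A32 $ c) (A33 $ c) $ q)"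

text \<open>The stages \<open>1, \<dots>, N\<close> index block rows and columns through a finite linearly ordered
  type \<open>'n\<close> with \<open>N = CARD('n)\<close>; \<open>stage i\<close> is the number of the stage \<open>i\<close>, and \<open>stage\<close> is a
  bijection onto \<open>{1..N}\<close>.\<close>

definition stage :: "'n::{finite,linorder} \<Rightarrow> nat" where
  "stage i = card {..i}"

lemma stage_bij: "bij_betw stage (UNIV :: 'n::{finite,linorder} set) {1..CARD('n)}"
proof -
  have lt: "stage i < stage j" if "i < j" for i j :: 'n
    unfolding stage_def using that by (intro psubset_card_mono) (auto simp: less_le_not_le)
  then have inj: "inj (stage :: 'n \<Rightarrow> nat)" by (metis injI linorder_neq_iff less_irrefl)
  have "stage i \<in> {1..CARD('n)}" for i :: 'n
    by (auto simp: stage_def Suc_le_eq card_gt_0_iff intro: card_mono)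
  then have "range (stage :: 'n \<Rightarrow> nat) = {1..CARD('n)}"
    by (intro card_subset_eq) (auto simp: card_image[OF inj])
  with inj show ?thesis by (simp add: bij_betw_def)
qed

definition block_diag :: "('n::finite \<Rightarrow> real^'b::finite^'b) \<Rightarrow> real^('n \<times> 'b)^('n \<times> 'b)" where
  "block_diag A = (\<chi> p q. if fst p = fst q then A (fst p) $ snd p $ snd q else 0)"

definition M_L :: "real^('x::finite + 'u::finite + 'x)^('x + 'u + 'x)" where
  "M_L = block3 (mat 1) 0 0  0 0 0  0 0 0"

definition M_U :: "real^('x::finite + 'u::finite + 'x)^('x + 'u + 'x)" where
  "M_U = block3 0 0 0  0 0 0  0 0 (mat 1)"

definition L_mat ::
    "real^('n::{finite,linorder} \<times> ('x::finite + 'u::finite + 'x))^('n \<times> ('x + 'u + 'x))" where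
  "L_mat = (\<chi> p q. if stage (fst p) = stage (fst q) + 1 then M_L $ snd p $ snd q else 0)"

definition U_mat ::
    "real^('n::{finite,linorder} \<times> ('x::finite + 'u::finite + 'x))^('n \<times> ('x + 'u + 'x))" where
  "U_mat = (\<chi> p q. if stage (fst q) = stage (fst p) + 1 then M_U $ snd p $ snd q else 0)"


section \<open>The relaxed regularized NMPC problem and its KKT equations\<close>

text \<open>The data of the problem except for the horizon. Stage-dependent data are indexed by
  \<open>1, \<dots>, N\<close>; values at other indices are irrelevant.\<close>

record ('u, 'x) nmpc =
  u_lo :: "real^'u"
  u_up :: "real^'u"
  x_lo :: "real^'x"
  x_up :: "real^'x"
  dyn :: "real^'u \<Rightarrow> real^'x \<Rightarrow> real^'x"
  cost :: "nat \<Rightarrow> real^'u \<Rightarrow> real^'x \<Rightarrow> real"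
  reg_par :: real
  bar_par :: real
  u_ref :: "nat \<Rightarrow> real^'u"
  x_init :: "real^'x"

definition G :: "('u::finite, 'x::finite) nmpc \<Rightarrow> real^'u \<Rightarrow> real^'x \<Rightarrow>
    real^(('u + 'u) + ('x + 'x))" where
  "G P u x = (\<chi> j. case j of
       Inl (Inl b) \<Rightarrow> u $ b - u_lo P $ b
     | Inl (Inr b) \<Rightarrow> u_up P $ b - u $ b
     | Inr (Inl a) \<Rightarrow> x $ a - x_lo P $ a
     | Inr (Inr a) \<Rightarrow> x_up P $ a - x $ a)"

definition barrier :: "('u::finite, 'x::finite) nmpc \<Rightarrow> real^'u \<Rightarrow> real^'x \<Rightarrow> real" where
  "barrier P u x = - bar_par P * (\<Sum>j\<in>UNIV. ln (G P u x $ j))"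

definition ham :: "('u::finite, 'x::finite) nmpc \<Rightarrow> nat \<Rightarrow>
    real^'u \<Rightarrow> real^'x \<Rightarrow> real^'x \<Rightarrow> real" where
  "ham P i u x lam = cost P i u x + barrier P u x + lam \<bullet> dyn P u x"

definition ham_u :: "('u::finite, 'x::finite) nmpc \<Rightarrow> nat \<Rightarrow>
    real^'u \<Rightarrow> real^'x \<Rightarrow> real^'x \<Rightarrow> real^'u" where
  "ham_u P i u x lam = grad (\<lambda>v. ham P i v x lam) u"

definition ham_x :: "('u::finite, 'x::finite) nmpc \<Rightarrow> nat \<Rightarrow>
    real^'u \<Rightarrow> real^'x \<Rightarrow> real^'x \<Rightarrow> real^'x" where
  "ham_x P i u x lam = grad (\<lambda>y. ham P i u y lam) x"

definition dyn_u :: "('u::finite, 'x::finite) nmpc \<Rightarrow> real^'u \<Rightarrow> real^'x \<Rightarrow> real^'u^'x" where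
  "dyn_u P u x = jacobian (\<lambda>v. dyn P v x) (at u)"

definition dyn_x :: "('u::finite, 'x::finite) nmpc \<Rightarrow> real^'u \<Rightarrow> real^'x \<Rightarrow> real^'x^'x" where
  "dyn_x P u x = jacobian (\<lambda>y. dyn P u y) (at x)"

definition kkt :: "('u::finite, 'x::finite) nmpc \<Rightarrow> real \<Rightarrow> nat \<Rightarrow>
    real^'x \<Rightarrow> real^('x + 'u + 'x) \<Rightarrow> real^'x \<Rightarrow> real^('x + 'u + 'x)" where
  "kkt P h i xprev s lamnext =
     (let x = x_of s; u = u_of s; lam = lam_of s in
      stack3 (xprev - x + h *\<^sub>R dyn P u x)
             (h *\<^sub>R ham_u P i u x lam + reg_par P *\<^sub>R (u - u_ref P i))
             (lamnext - lam + h *\<^sub>R ham_x P i u x lam))"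

text \<open>A point \<open>S = (s\<^sub>1, \<dots>, s\<^sub>N)\<close> is a function on stage numbers; the boundary values
  \<open>x\<^sub>0 = x_init\<close> and \<open>\<lambda>\<^bsub>N+1\<^esub> = 0\<close> are built into the following two functions.\<close>

definition x_prev :: "('u::finite, 'x::finite) nmpc \<Rightarrow> (nat \<Rightarrow> real^('x + 'u + 'x)) \<Rightarrow>
    nat \<Rightarrow> real^'x" where
  "x_prev P S i = (if i = 1 then x_init P else x_of (S (i - 1)))"

definition lam_next :: "nat \<Rightarrow> (nat \<Rightarrow> real^('x::finite + 'u::finite + 'x)) \<Rightarrow> nat \<Rightarrow> real^'x" where
  "lam_next N S i = (if i = N then 0 else lam_of (S (i + 1)))"

definition kkt_solution :: "('u::finite, 'x::finite) nmpc \<Rightarrow> nat \<Rightarrow> real \<Rightarrow>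
    (nat \<Rightarrow> real^('x + 'u + 'x)) \<Rightarrow> bool" where
  "kkt_solution P N h S \<longleftrightarrow>
     (\<forall>i\<in>{1..N}. kkt P h i (x_prev P S i) (S i) (lam_next N S i) = 0 \<and>
        (\<forall>j. G P (u_of (S i)) (x_of (S i)) $ j > 0))"


section \<open>The iteration matrices\<close>

definition D_block :: "('u::finite, 'x::finite) nmpc \<Rightarrow> nat \<Rightarrow> real \<Rightarrow>
    (nat \<Rightarrow> real^('x + 'u + 'x)) \<Rightarrow> nat \<Rightarrow> real^('x + 'u + 'x)^('x + 'u + 'x)" where
  "D_block P N h S i = jacobian (\<lambda>s. kkt P h i (x_prev P S i) s (lam_next N S i)) (at (S i))"

text \<open>In \<open>\<nabla>\<^sup>2\<^sub>u\<^sub>x H\<close> rows belong to \<open>u\<close> and columns to \<open>x\<close>: it is the Jacobian with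
  respect to \<open>x\<close> of the gradient with respect to \<open>u\<close>.\<close>

definition Dbar_block :: "('u::finite, 'x::finite) nmpc \<Rightarrow> real \<Rightarrow>
    (nat \<Rightarrow> real^('x + 'u + 'x)) \<Rightarrow> nat \<Rightarrow> real^('x + 'u + 'x)^('x + 'u + 'x)" where
  "Dbar_block P h S i =
     (let x = x_of (S i); u = u_of (S i); lam = lam_of (S i);
          H_ux = jacobian (\<lambda>y. ham_u P i u y lam) (at x);
          H_uu = jacobian (\<lambda>v. ham_u P i v x lam) (at u);
          H_xx = jacobian (\<lambda>y. ham_x P i u y lam) (at x);
          H_xu = jacobian (\<lambda>v. ham_x P i v x lam) (at u)
      in block3
        (h *\<^sub>R dyn_x P u x - mat 1)  0                            0
        (h *\<^sub>R H_ux)                 (h *\<^sub>R H_uu + mat (reg_par P))   0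
        (h *\<^sub>R H_xx)                 (h *\<^sub>R H_xu)                 (h *\<^sub>R transpose (dyn_x P u x) - mat 1))"

definition Dtilde_block :: "real^'u::finite^'x::finite \<Rightarrow> real^('x + 'u + 'x)^('x + 'u + 'x)" where
  "Dtilde_block B = block3  0 B 0  0 0 (transpose B)  0 0 0"

definition D_star :: "('u::finite, 'x::finite) nmpc \<Rightarrow> real \<Rightarrow> (nat \<Rightarrow> real^('x + 'u + 'x)) \<Rightarrow>
    real^('n::{finite,linorder} \<times> ('x + 'u + 'x))^('n \<times> ('x + 'u + 'x))" where
  "D_star P h S = block_diag (\<lambda>i. D_block P CARD('n) h S (stage i))"

definition Dbar_star :: "('u::finite, 'x::finite) nmpc \<Rightarrow> real \<Rightarrow> (nat \<Rightarrow> real^('x + 'u + 'x)) \<Rightarrow>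
    real^('n::{finite,linorder} \<times> ('x + 'u + 'x))^('n \<times> ('x + 'u + 'x))" where
  "Dbar_star P h S = block_diag (\<lambda>i. Dbar_block P h S (stage i))"

definition Dtilde_star :: "('n::{finite,linorder} \<Rightarrow> real^'u::finite^'x::finite) \<Rightarrow>
    real^('n \<times> ('x + 'u + 'x))^('n \<times> ('x + 'u + 'x))" where
  "Dtilde_star B = block_diag (\<lambda>i. Dtilde_block (B i))"


section \<open>The decomposition of the diagonal blocks\<close>

text \<open>The Jacobians that form \<open>D_star\<close> have the block form \<open>Dbar + h Dtilde\<close>, where
  \<open>Dtilde\<close> is built from \<open>\<nabla>\<^sub>u f\<close>; see \<open>kkt_jacobian\<close> below.\<close>

lemma jacobian_line:
  fixes f :: "real^'a::finite \<Rightarrow> real^'b::finite"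
  assumes "f differentiable (at a)"
  shows "((\<lambda>t. f (a + t *\<^sub>R axis q 1) $ p) has_real_derivative jacobian f (at a) $ p $ q) (at 0)"
proof -
  have d: "(f has_derivative (\<lambda>v. jacobian f (at a) *v v)) (at a)"
    using assms jacobian_works by blast
  have "((\<lambda>t. f (a + t *\<^sub>R axis q 1)) has_derivative
      (\<lambda>t. jacobian f (at a) *v (t *\<^sub>R axis q 1))) (at 0)"
    by (rule has_derivative_compose[of "\<lambda>t. a + t *\<^sub>R axis q 1" _ 0 UNIV f, simplified])
      (auto intro!: derivative_eq_intros d)
  then have "((\<lambda>t. f (a + t *\<^sub>R axis q 1) $ p) has_derivative
      (\<lambda>t. (jacobian f (at a) *v (t *\<^sub>R axis q 1)) $ p)) (at 0)"
    by (rule bounded_linear.has_derivative[OF bounded_linear_vec_nth])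
  moreover have "(\<lambda>t. (jacobian f (at a) *v (t *\<^sub>R axis q 1)) $ p)
      = (*) (jacobian f (at a) $ p $ q)"
    by (simp add: fun_eq_iff matrix_vector_mult_scaleR matrix_vector_mul_component
        inner_axis mult.commute)
  ultimately show ?thesis by (simp add: has_field_derivative_def)
qed

lemma grad_component:
  assumes "(g has_derivative g') (at v)"
  shows "grad g v $ j = g' (axis j 1)"
  using frechet_derivative_at[OF assms] by (simp add: grad_def)

definition G_lin :: "(real^'u::finite) \<times> (real^'x::finite) \<Rightarrow> real^(('u + 'u) + ('x + 'x))" where
  "G_lin w = (\<chi> j. case j of
       Inl (Inl b) \<Rightarrow> fst w $ b
     | Inl (Inr b) \<Rightarrow> - fst w $ b
     | Inr (Inl a) \<Rightarrow> snd w $ a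
     | Inr (Inr a) \<Rightarrow> - snd w $ a)"

lemma G_deriv: "((\<lambda>z. G P (fst z) (snd z) $ j) has_derivative (\<lambda>w. G_lin w $ j)) (at z)"
proof -
  have "bounded_linear (\<lambda>w. G_lin w $ j)"
    unfolding G_lin_def
    by (cases j; rename_tac k; case_tac k; simp;
        intro bounded_linear_minus bounded_linear_compose[OF bounded_linear_vec_nth]
          bounded_linear_fst bounded_linear_snd)
  moreover have "(\<lambda>z. G P (fst z) (snd z) $ j) = (\<lambda>z. G_lin z $ j + G P 0 0 $ j)"
    by (auto simp: G_def G_lin_def fun_eq_iff split: sum.splits)
  ultimately show ?thesis
    by (auto intro!: derivative_eq_intros bounded_linear_imp_has_derivative)
qed

lemma barrier_deriv:
  assumes "\<forall>j. G P (fst z) (snd z) $ j > 0"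
  shows "((\<lambda>z. barrier P (fst z) (snd z)) has_derivative
    (\<lambda>w. - bar_par P * (\<Sum>j\<in>UNIV. G_lin w $ j / G P (fst z) (snd z) $ j))) (at z)"
  unfolding barrier_def using assms
  by (auto intro!: derivative_eq_intros G_deriv simp: field_simps)

lemma G_pos_open: "open {z. \<forall>j. G P (fst z) (snd z) $ j > 0}"
proof -
  have "continuous_on UNIV (\<lambda>z. G P (fst z) (snd z) $ j)" for j
    using G_deriv[of P j] has_derivative_continuous continuous_at_imp_continuous_on by blast
  then have "open {z. G P (fst z) (snd z) $ j > 0}" for j
    by (intro open_Collect_less[OF continuous_on_const])
  then have "open (\<Inter>j. {z. G P (fst z) (snd z) $ j > 0})" by (intro open_INT) auto
  then show ?thesis by (simp add: Collect_all_eq)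
qed


definition ham_dir where
  "ham_dir P C F z lam w = blinfun_apply (C z) w
     - bar_par P * (\<Sum>j\<in>UNIV. G_lin w $ j / G P (fst z) (snd z) $ j)
     + lam \<bullet> blinfun_apply (F z) w"

lemma ham_deriv:
  assumes F: "\<forall>z. ((\<lambda>(u, x). dyn P u x) has_derivative blinfun_apply (F z)) (at z)"
    and C: "\<forall>z. ((\<lambda>(u, x). cost P i u x) has_derivative blinfun_apply (C z)) (at z)"
    and pos: "\<forall>j. G P (fst z) (snd z) $ j > 0"
  shows "((\<lambda>z. ham P i (fst z) (snd z) lam) has_derivative ham_dir P C F z lam) (at z)"
proof -
  have F': "((\<lambda>z. dyn P (fst z) (snd z)) has_derivative blinfun_apply (F z)) (at z)"
    using F[rule_format, of z] by (simp add: case_prod_unfold)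
  have C': "((\<lambda>z. cost P i (fst z) (snd z)) has_derivative blinfun_apply (C z)) (at z)"
    using C[rule_format, of z] by (simp add: case_prod_unfold)
  show ?thesis
    unfolding ham_def ham_dir_def
    by (rule derivative_eq_intros C' F' barrier_deriv[OF pos] refl)+ (auto simp: fun_eq_iff)
qed

lemma ham_u_component:
  assumes "\<forall>z. ((\<lambda>(u, x). dyn P u x) has_derivative blinfun_apply (F z)) (at z)"
    and "\<forall>z. ((\<lambda>(u, x). cost P i u x) has_derivative blinfun_apply (C z)) (at z)"
    and "\<forall>j. G P u x $ j > 0"
  shows "ham_u P i u x lam $ b = ham_dir P C F (u, x) lam (axis b 1, 0)"
proof -
  have "((\<lambda>v. ham P i v x lam) has_derivative (\<lambda>w. ham_dir P C F (u, x) lam (w, 0))) (at u)"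
  proof -
    have p: "\<forall>j. G P (fst (u, x)) (snd (u, x)) $ j > 0" using assms(3) by simp
    have "((\<lambda>v. (v, x)) has_derivative (\<lambda>w. (w, 0))) (at u)"
      by (auto intro!: derivative_eq_intros)
    from has_derivative_compose[OF this ham_deriv[OF assms(1,2) p]] show ?thesis by simp
  qed
  then show ?thesis unfolding ham_u_def by (rule grad_component)
qed

lemma ham_x_component:
  assumes "\<forall>z. ((\<lambda>(u, x). dyn P u x) has_derivative blinfun_apply (F z)) (at z)"
    and "\<forall>z. ((\<lambda>(u, x). cost P i u x) has_derivative blinfun_apply (C z)) (at z)"
    and "\<forall>j. G P u x $ j > 0"
  shows "ham_x P i u x lam $ a = ham_dir P C F (u, x) lam (0, axis a 1)"
proof -
  have "((\<lambda>y. ham P i u y lam) has_derivative (\<lambda>w. ham_dir P C F (u, x) lam (0, w))) (at x)"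
  proof -
    have p: "\<forall>j. G P (fst (u, x)) (snd (u, x)) $ j > 0" using assms(3) by simp
    have "((\<lambda>y. (u, y)) has_derivative (\<lambda>w. (0, w))) (at x)"
      by (auto intro!: derivative_eq_intros)
    from has_derivative_compose[OF this ham_deriv[OF assms(1,2) p]] show ?thesis by simp
  qed
  then show ?thesis unfolding ham_x_def by (rule grad_component)
qed

lemma vec_differentiable:
  fixes f :: "'a::real_normed_vector \<Rightarrow> real^'b::finite"
  assumes "\<And>p. (\<lambda>s. f s $ p) differentiable (at a)"
  shows "f differentiable (at a)"
proof -
  have "(\<lambda>s. \<Sum>p\<in>UNIV. (f s $ p) *\<^sub>R axis p (1::real)) differentiable (at a)"
    using assms by (intro differentiable_sum) (auto intro!: differentiable_scaleR)
  moreover have "(\<lambda>s. \<Sum>p\<in>UNIV. (f s $ p) *\<^sub>R axis p (1::real)) = f"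
    by (auto simp: fun_eq_iff vec_eq_iff axis_def if_distrib cong: if_cong)
  ultimately show ?thesis by simp
qed

lemma ham_dir_differentiable:
  assumes F: "\<forall>z. F differentiable (at z)" and C: "\<forall>z. C differentiable (at z)"
    and Z: "Z differentiable (at c)" and L: "Lm differentiable (at c)"
    and pos: "\<forall>j. G P (fst (Z c)) (snd (Z c)) $ j > 0"
  shows "(\<lambda>c. ham_dir P C F (Z c) (Lm c) w) differentiable (at c)"
proof -
  have ap: "(\<lambda>c. blinfun_apply (H (Z c)) w) differentiable (at c)"
    if "\<forall>z. H differentiable (at z)" for H :: "_ \<Rightarrow> _ \<Rightarrow>\<^sub>L 'z::real_normed_vector"
  proof -
    have "(\<lambda>c. H (Z c)) differentiable (at c)"
      using that Z differentiable_compose[of H Z c UNIV] differentiable_at_withinI by blast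
    then obtain D where "((\<lambda>c. H (Z c)) has_derivative D) (at c)"
      unfolding differentiable_def by blast
    from bounded_linear.has_derivative[OF blinfun.bounded_linear_left this]
    show ?thesis unfolding differentiable_def by blast
  qed
  have g: "(\<lambda>c. G P (fst (Z c)) (snd (Z c)) $ j) differentiable (at c)" for j
  proof -
    have "(\<lambda>z. G P (fst z) (snd z) $ j) differentiable (at (Z c))"
      using G_deriv differentiable_def by blast
    then show ?thesis
      using Z differentiable_compose[of "\<lambda>z. G P (fst z) (snd z) $ j" Z c UNIV]
        differentiable_at_withinI by blast
  qed
  have p: "G P (fst (Z c)) (snd (Z c)) $ j \<noteq> 0" for j using pos by (metis less_irrefl)
  show ?thesis unfolding ham_dir_def
    by (intro differentiable_add differentiable_diff differentiable_mult differentiable_const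
        differentiable_sum differentiable_divide differentiable_inner ap F C g p L finite ballI)
qed

lemma ham_grads_differentiable:
  assumes "twice_differentiable (\<lambda>(u, x). dyn P u x)"
    and "twice_differentiable (\<lambda>(u, x). cost P i u x)"
    and U: "U differentiable (at c)" and X: "X differentiable (at c)" and L: "Lm differentiable (at c)"
    and pos: "\<forall>j. G P (U c) (X c) $ j > 0"
  shows "(\<lambda>c. ham_u P i (U c) (X c) (Lm c)) differentiable (at c)"
    and "(\<lambda>c. ham_x P i (U c) (X c) (Lm c)) differentiable (at c)"
proof -
  obtain F where F: "\<forall>z. ((\<lambda>(u, x). dyn P u x) has_derivative blinfun_apply (F z)) (at z)"
    "\<forall>z. F differentiable (at z)" using assms(1) unfolding twice_differentiable_def by blast
  obtain C where C: "\<forall>z. ((\<lambda>(u, x). cost P i u x) has_derivative blinfun_apply (C z)) (at z)"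
    "\<forall>z. C differentiable (at z)" using assms(2) unfolding twice_differentiable_def by blast
  have Z: "(\<lambda>c. (U c, X c)) differentiable (at c)"
    using U X unfolding differentiable_def by (blast intro: has_derivative_Pair)
  have ev: "eventually (\<lambda>c. \<forall>j. G P (U c) (X c) $ j > 0) (at c)"
  proof -
    have "((\<lambda>c. (U c, X c)) \<longlongrightarrow> (U c, X c)) (at c)"
      using Z differentiable_imp_continuous_within continuous_within by blast
    from topological_tendstoD[OF this G_pos_open[of P]] pos show ?thesis by simp
  qed
  have d: "(\<lambda>c. ham_dir P C F (U c, X c) (Lm c) w) differentiable (at c)" for w
    using ham_dir_differentiable[OF F(2) C(2) Z L] pos by simp
  have tr: "f differentiable (at c)" if "g differentiable (at c)"
    "eventually (\<lambda>c. g c = f c) (at c)" "g c = f c" for f g :: "_ \<Rightarrow> real"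
    using that unfolding differentiable_def
    by (metis UNIV_I has_derivative_transform_eventually)
  show "(\<lambda>c. ham_u P i (U c) (X c) (Lm c)) differentiable (at c)"
  proof (rule vec_differentiable, rule tr[OF d])
    fix b
    show "\<forall>\<^sub>F c in at c. ham_dir P C F (U c, X c) (Lm c) (axis b 1, 0)
        = ham_u P i (U c) (X c) (Lm c) $ b"
      using ev by eventually_elim (simp add: ham_u_component[OF F(1) C(1)])
    show "ham_dir P C F (U c, X c) (Lm c) (axis b 1, 0) = ham_u P i (U c) (X c) (Lm c) $ b"
      using pos by (simp add: ham_u_component[OF F(1) C(1)])
  qed
  show "(\<lambda>c. ham_x P i (U c) (X c) (Lm c)) differentiable (at c)"
  proof (rule vec_differentiable, rule tr[OF d])
    fix b
    show "\<forall>\<^sub>F c in at c. ham_dir P C F (U c, X c) (Lm c) (0, axis b 1)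
        = ham_x P i (U c) (X c) (Lm c) $ b"
      using ev by eventually_elim (simp add: ham_x_component[OF F(1) C(1)])
    show "ham_dir P C F (U c, X c) (Lm c) (0, axis b 1) = ham_x P i (U c) (X c) (Lm c) $ b"
      using pos by (simp add: ham_x_component[OF F(1) C(1)])
  qed
qed


lemma dyn_partials:
  assumes F: "\<forall>z. ((\<lambda>(u, x). dyn P u x) has_derivative blinfun_apply (F z)) (at z)"
  shows "dyn_u P u x $ c $ b = blinfun_apply (F (u, x)) (axis b 1, 0) $ c"
    and "dyn_x P u x $ c $ a = blinfun_apply (F (u, x)) (0, axis a 1) $ c"
proof -
  have "((\<lambda>v. (v, x)) has_derivative (\<lambda>w. (w, 0))) (at u)" 
    "((\<lambda>y. (u, y)) has_derivative (\<lambda>w. (0, w))) (at x)"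
    by (auto intro!: derivative_eq_intros)
  then have "((\<lambda>v. dyn P v x) has_derivative (\<lambda>w. blinfun_apply (F (u, x)) (w, 0))) (at u)"
    "((\<lambda>y. dyn P u y) has_derivative (\<lambda>w. blinfun_apply (F (u, x)) (0, w))) (at x)"
    using has_derivative_compose F[rule_format, of "(u, x)"] by fastforce+
  from this[THEN frechet_derivative_at, symmetric]
  show "dyn_u P u x $ c $ b = blinfun_apply (F (u, x)) (axis b 1, 0) $ c"
    "dyn_x P u x $ c $ a = blinfun_apply (F (u, x)) (0, axis a 1) $ c"
    by (simp_all add: dyn_u_def dyn_x_def jacobian_def matrix_def)
qed

lemma ham_lam_line:
  assumes F: "\<forall>z. ((\<lambda>(u, x). dyn P u x) has_derivative blinfun_apply (F z)) (at z)"
    and C: "\<forall>z. ((\<lambda>(u, x). cost P i u x) has_derivative blinfun_apply (C z)) (at z)"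
    and pos: "\<forall>j. G P u x $ j > 0"
  shows "ham_u P i u x (lam + t *\<^sub>R axis c 1) $ b = ham_u P i u x lam $ b + t * dyn_u P u x $ c $ b"
    and "ham_x P i u x (lam + t *\<^sub>R axis c 1) $ a = ham_x P i u x lam $ a + t * dyn_x P u x $ c $ a"
  by (simp_all add: ham_u_component[OF F C pos] ham_x_component[OF F C pos] dyn_partials[OF F]
      ham_dir_def inner_add_left inner_axis')

lemma of_lines:
  "x_of (s + t *\<^sub>R axis (Inl c) 1) = x_of s + t *\<^sub>R axis c 1"
  "u_of (s + t *\<^sub>R axis (Inl c) 1) = u_of s"
  "lam_of (s + t *\<^sub>R axis (Inl c) 1) = lam_of s"
  "x_of (s + t *\<^sub>R axis (Inr (Inl d)) 1) = x_of s"
  "u_of (s + t *\<^sub>R axis (Inr (Inl d)) 1) = u_of s + t *\<^sub>R axis d 1"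
  "lam_of (s + t *\<^sub>R axis (Inr (Inl d)) 1) = lam_of s"
  "x_of (s + t *\<^sub>R axis (Inr (Inr c)) 1) = x_of s"
  "u_of (s + t *\<^sub>R axis (Inr (Inr c)) 1) = u_of s"
  "lam_of (s + t *\<^sub>R axis (Inr (Inr c)) 1) = lam_of s + t *\<^sub>R axis c 1"
  by (auto simp: x_of_def u_of_def lam_of_def vec_eq_iff axis_def)

lemma of_differentiable:
  "x_of differentiable (at s)" "u_of differentiable (at s)" "lam_of differentiable (at s)"
  by (rule vec_differentiable; simp add: x_of_def u_of_def lam_of_def
      bounded_linear_imp_differentiable bounded_linear_vec_nth)+

lemma differentiable_nth:
  fixes W :: "'c::real_normed_vector \<Rightarrow> real^'d::finite"
  assumes "W differentiable (at c)"
  shows "(\<lambda>c. W c $ k) differentiable (at c)"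
  using assms bounded_linear.has_derivative[OF bounded_linear_vec_nth]
  unfolding differentiable_def by blast

lemma kkt_jacobian:
  assumes f: "twice_differentiable (\<lambda>(u, x). dyn P u x)"
    and l: "twice_differentiable (\<lambda>(u, x). cost P i u x)"
    and pos: "\<forall>j. G P (u_of (S i)) (x_of (S i)) $ j > 0"
  shows "D_block P N h S i = Dbar_block P h S i
    + h *\<^sub>R Dtilde_block (dyn_u P (u_of (S i)) (x_of (S i)))"
proof -
  define s u x lam where defs: "s = S i" "u = u_of s" "x = x_of s" "lam = lam_of s"
  define xp ln where "xp = x_prev P S i" "ln = lam_next N S i"
  have pos': "\<forall>j. G P u x $ j > 0" using pos by (simp add: defs)
  have ax: "axis c (1::real) $ a = (if a = c then 1 else 0)" for a c :: "'k::finite"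
    by (simp add: axis_def)
  let ?K = "\<lambda>s. kkt P h i xp s ln"
  obtain F where F: "\<forall>z. ((\<lambda>(u, x). dyn P u x) has_derivative blinfun_apply (F z)) (at z)"
    using f unfolding twice_differentiable_def by blast
  obtain C where C: "\<forall>z. ((\<lambda>(u, x). cost P i u x) has_derivative blinfun_apply (C z)) (at z)"
    using l unfolding twice_differentiable_def by blast
  have dd: "(\<lambda>c. dyn P (U c) (X c)) differentiable (at c)"
    if "U differentiable (at c)" "X differentiable (at c)" for U X and c :: "'c::real_normed_vector"
  proof -
    have "(\<lambda>c. (U c, X c)) differentiable (at c)"
      using that unfolding differentiable_def by (blast intro: has_derivative_Pair)
    then obtain D where "((\<lambda>c. (U c, X c)) has_derivative D) (at c)"
      unfolding differentiable_def by blast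
    from has_derivative_compose[OF this F[rule_format]] show ?thesis
      unfolding differentiable_def by auto
  qed
  note hd = ham_grads_differentiable[OF f l]
  have pos'': "\<forall>j. G P (u_of s) (x_of s) $ j > 0" using pos' defs by simp
  have K: "?K differentiable (at s)"
  proof (rule vec_differentiable)
    fix p
    have "(\<lambda>s. xp - x_of s + h *\<^sub>R dyn P (u_of s) (x_of s)) differentiable (at s)"
      "(\<lambda>s. h *\<^sub>R ham_u P i (u_of s) (x_of s) (lam_of s) + reg_par P *\<^sub>R (u_of s - u_ref P i))
         differentiable (at s)"
      "(\<lambda>s. ln - lam_of s + h *\<^sub>R ham_x P i (u_of s) (x_of s) (lam_of s)) differentiable (at s)"
      by (intro differentiable_add differentiable_diff differentiable_const differentiable_scaleR
          of_differentiable dd hd pos'')+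
    note n = this[THEN differentiable_nth]
    show "(\<lambda>s. ?K s $ p) differentiable (at s)"
    proof (cases p)
      case (Inr r)
      then show ?thesis
        using n by (cases r) (simp_all add: kkt_def Let_def stack3_def)
    qed (use n in \<open>simp add: kkt_def Let_def stack3_def\<close>)
  qed
  note JK = jacobian_line[OF K]
  have dx: "((\<lambda>t. dyn P u (x + t *\<^sub>R axis q 1) $ p) has_real_derivative dyn_x P u x $ p $ q) (at 0)"
    for p q unfolding dyn_x_def by (intro jacobian_line dd differentiable_const differentiable_ident)
  have du: "((\<lambda>t. dyn P (u + t *\<^sub>R axis q 1) x $ p) has_real_derivative dyn_u P u x $ p $ q) (at 0)"
    for p q unfolding dyn_u_def by (intro jacobian_line dd differentiable_const differentiable_ident)
  have ux: "((\<lambda>t. ham_u P i u (x + t *\<^sub>R axis q 1) lam $ p) has_real_derivative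
      jacobian (\<lambda>y. ham_u P i u y lam) (at x) $ p $ q) (at 0)"
    and uu: "((\<lambda>t. ham_u P i (u + t *\<^sub>R axis q' 1) x lam $ p) has_real_derivative
      jacobian (\<lambda>v. ham_u P i v x lam) (at u) $ p $ q') (at 0)"
    and xx: "((\<lambda>t. ham_x P i u (x + t *\<^sub>R axis q 1) lam $ p') has_real_derivative
      jacobian (\<lambda>y. ham_x P i u y lam) (at x) $ p' $ q) (at 0)"
    and xu: "((\<lambda>t. ham_x P i (u + t *\<^sub>R axis q' 1) x lam $ p') has_real_derivative
      jacobian (\<lambda>v. ham_x P i v x lam) (at u) $ p' $ q') (at 0)"
    for p q p' q'
    by (intro jacobian_line hd differentiable_const differentiable_ident pos')+
  let ?B = "Dbar_block P h S i + h *\<^sub>R Dtilde_block (dyn_u P u x)"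
  have "jacobian ?K (at s) $ p $ q = ?B $ p $ q" for p q
  proof (rule DERIV_unique[OF JK])
    show "((\<lambda>t. ?K (s + t *\<^sub>R axis q 1) $ p) has_real_derivative ?B $ p $ q) (at 0)"
    proof (cases p)
      case p: (Inl a)
      show ?thesis
      proof (cases q)
        case q: (Inl c)
        show ?thesis
          by (simp add: p q kkt_def Let_def stack3_def Dbar_block_def Dtilde_block_def block3_def
              of_lines flip: defs) (auto intro!: derivative_eq_intros dx simp: ax mat_def)
      next
        case q': (Inr r)
        show ?thesis
        proof (cases r)
          case q: (Inl c)
          show ?thesis
            by (simp add: p q' q kkt_def Let_def stack3_def Dbar_block_def Dtilde_block_def
                block3_def of_lines flip: defs) (auto intro!: derivative_eq_intros du)
        next
          case q: (Inr c)
          show ?thesis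
            by (simp add: p q' q kkt_def Let_def stack3_def Dbar_block_def Dtilde_block_def
                block3_def of_lines flip: defs)
        qed
      qed
    next
      case p': (Inr r')
      show ?thesis
      proof (cases r')
        case p: (Inl a)
        show ?thesis
        proof (cases q)
          case q: (Inl c)
          show ?thesis
            by (simp add: p p' q kkt_def Let_def stack3_def Dbar_block_def Dtilde_block_def
                block3_def of_lines flip: defs) (auto intro!: derivative_eq_intros ux)
        next
          case q': (Inr r)
          show ?thesis
          proof (cases r)
            case q: (Inl c)
            show ?thesis
              by (simp add: p p' q' q kkt_def Let_def stack3_def Dbar_block_def Dtilde_block_def
                  block3_def of_lines flip: defs)
                (auto intro!: derivative_eq_intros uu simp: ax mat_def)
          next
            case q: (Inr c)
            show ?thesis
              by (simp add: p p' q' q kkt_def Let_def stack3_def Dbar_block_def Dtilde_block_def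
                  block3_def of_lines ham_lam_line[OF F C pos'] transpose_def flip: defs)
                (auto intro!: derivative_eq_intros)
          qed
        qed
      next
        case p: (Inr a)
        show ?thesis
        proof (cases q)
          case q: (Inl c)
          show ?thesis
            by (simp add: p p' q kkt_def Let_def stack3_def Dbar_block_def Dtilde_block_def
                block3_def of_lines flip: defs) (auto intro!: derivative_eq_intros xx)
        next
          case q': (Inr r)
          show ?thesis
          proof (cases r)
            case q: (Inl c)
            show ?thesis
              by (simp add: p p' q' q kkt_def Let_def stack3_def Dbar_block_def Dtilde_block_def
                  block3_def of_lines flip: defs) (auto intro!: derivative_eq_intros xu)
          next
            case q: (Inr c)
            show ?thesis
              by (simp add: p p' q' q kkt_def Let_def stack3_def Dbar_block_def Dtilde_block_def
                  block3_def of_lines ham_lam_line[OF F C pos'] transpose_def flip: defs)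
                (auto intro!: derivative_eq_intros simp: ax mat_def)
          qed
        qed
      qed
    qed
  qed
  then show ?thesis
    unfolding D_block_def by (simp add: vec_eq_iff defs xp_ln_def)
qed

end

theory Submission
  imports Defs "HOL-Computational_Algebra.Fundamental_Theorem_Algebra"
begin

text \<open>
  Both parts follow from the regularity of a matrix pencil: if \<open>(D - \<nu> (L + U)) v = 0\<close> with
  \<open>\<bar>\<nu>\<bar> \<le> 1\<close> forces \<open>v = 0\<close>, then \<open>D\<close> is invertible and every eigenvalue of \<open>D\<^sup>-\<^sup>1 (L + U)\<close> has
  modulus less than one (\<open>pencil_regular_imp_spectral_radius\<close>). The pencil equation is a recursion over
  the stages: the state of stage \<open>i\<close> is driven by the state of stage \<open>i - 1\<close>, starting from zero, and the
  costate of stage \<open>i\<close> by the costate of stage \<open>i + 1\<close>, ending at zero.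

  For a short horizon, the solutions of the KKT equations are controlled uniformly. The states stay
  close to the initial state (\<open>state_drift\<close>), the costates are bounded (\<open>costate_le_1\<close>), and all second
  derivatives are bounded by compactness (\<open>stage_bounds\<close>), with one exception: the barrier contributes to
  the derivatives with respect to the inputs a diagonal matrix that may be arbitrarily large but is
  nonnegative. So, up to terms of order \<open>h\<close>, the diagonal blocks of \<open>D\<close> are diagonal, with entries
  \<open>-1\<close> for states and costates and at least \<open>\<gamma>\<close> for inputs. For small \<open>h\<close> the forward and backward sweeps
  over the stages then show that all components of \<open>v\<close> are smaller than the largest one unless \<open>v\<close>
  vanishes (\<open>pencil_regular_diag_dominant\<close>).

  For the second part, the pencil with \<open>Dbar\<close> in place of \<open>D\<close> is regular because \<open>Dbar\<close> is block
  triangular, so that the sweeps give \<open>v = 0\<close> exactly (\<open>pencil_regular_block_triangular\<close>). Regularity is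
  stable under small perturbations of \<open>D\<close> by compactness (\<open>pencil_regular_perturb\<close>).
\<close>

section \<open>Eigenvalues and regular pencils\<close>

lemma ker_iff_det:
  fixes A :: "complex^'n::finite^'n"
  shows "(\<exists>v. v \<noteq> 0 \<and> A *v v = 0) \<longleftrightarrow> det A = 0"
  by (metis invertible_det_nz invertible_left_inverse matrix_left_invertible_ker)

text \<open>The spectral radius is a maximum over the set of eigenvalue moduli, which is informative only
  for a finite nonempty set. The eigenvalues are the roots of \<open>det (A - \<mu> I)\<close>, taken as a determinant
  over the ring of polynomials. Instead of computing the degree of this polynomial, its
  non-constancy is read off from the reversed polynomial \<open>q \<nu> = det (I - \<nu> A)\<close>, for which
  \<open>q 0 = 1\<close>.\<close>

lemma eigenvalues_finite_nonempty:
  fixes A :: "complex^'n::finite^'n"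
  shows "finite {\<mu>. \<exists>v. v \<noteq> 0 \<and> A *v v = \<mu> *s v}"
    and "{\<mu>. \<exists>v. v \<noteq> 0 \<and> A *v v = \<mu> *s v} \<noteq> {}"
proof -
  define p where "p = det (\<chi> i j. [:A$i$j:] - (if i = j then [:0,1:] else 0))"
  have p: "poly p \<mu> = det (\<chi> i j. A$i$j - (if i = j then \<mu> else 0))" for \<mu>
    by (auto simp: p_def det_def poly_sum poly_prod intro!: sum.cong prod.cong)
  have eig: "(\<exists>v. v \<noteq> 0 \<and> A *v v = \<mu> *s v) \<longleftrightarrow> poly p \<mu> = 0" for \<mu>
  proof -
    have "((\<chi> i j. A$i$j - (if i = j then \<mu> else 0)) *v v) = A *v v - \<mu> *s v" for v
      by (simp add: vec_eq_iff matrix_vector_mult_def left_diff_distrib sum_subtractf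
          if_distrib[of "\<lambda>x. x * _"] cong: if_cong)
    then show ?thesis unfolding p ker_iff_det[symmetric] by simp
  qed
  define q where "q \<nu> = det (\<chi> i j. (if i = j then 1 else 0) - \<nu> * A$i$j)" for \<nu>
  have q0: "q 0 = 1"
    using det_I[where 'a=complex and 'n='n] by (simp add: q_def mat_def)
  have qp: "q \<nu> = (- \<nu>) ^ CARD('n) * poly p (inverse \<nu>)" if "\<nu> \<noteq> 0" for \<nu>
  proof -
    have "(\<chi> i j. (if i = j then 1 else 0) - \<nu> * A$i$j)
        = (\<chi> i. (- \<nu>) *s (\<chi> j. A$i$j - (if i = j then inverse \<nu> else 0)))"
      using that by (auto simp: vec_eq_iff algebra_simps)
    then show ?thesis
      unfolding q_def p by (simp only: det_rows_mul prod_constant)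
  qed
  \<comment> \<open>If \<open>p\<close> were a constant \<open>c\<close>, then \<open>q \<nu> = c (- \<nu>)^n\<close> off the origin, so \<open>q 0 = 0\<close> by continuity.\<close>
  have nc: "\<not> constant (poly p)"
  proof
    assume "constant (poly p)"
    then obtain c where c: "poly p \<mu> = c" for \<mu> unfolding constant_def by blast
    have "isCont q 0" unfolding q_def det_def by (simp) (intro continuous_intros)
    then have "(q \<longlongrightarrow> 1) (at 0)" by (simp add: isCont_def q0)
    moreover have "(q \<longlongrightarrow> 0) (at 0)"
    proof (rule Lim_transform_eventually)
      have "((\<lambda>\<nu>. (- \<nu>) ^ CARD('n) * c) \<longlongrightarrow> (- 0) ^ CARD('n) * c) (at 0)"
        by (intro tendsto_intros)
      then show "((\<lambda>\<nu>. (- \<nu>) ^ CARD('n) * c) \<longlongrightarrow> 0) (at 0)" by (simp add: power_0_left)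
      show "\<forall>\<^sub>F \<nu> in at 0. (- \<nu>) ^ CARD('n) * c = q \<nu>"
        by (auto simp: eventually_at_filter qp c)
    qed
    ultimately show False using tendsto_unique[of "at (0::complex)" q 1 0] by simp
  qed
  then have "p \<noteq> 0" by (auto simp: constant_def)
  then show "finite {\<mu>. \<exists>v. v \<noteq> 0 \<and> A *v v = \<mu> *s v}"
    unfolding eig by (rule poly_roots_finite)
  show "{\<mu>. \<exists>v. v \<noteq> 0 \<and> A *v v = \<mu> *s v} \<noteq> {}"
    unfolding eig using fundamental_theorem_of_algebra[OF nc] by blast
qed

text \<open>A real matrix regarded as a complex one.\<close>

definition cmat :: "real^'m::finite^'n::finite \<Rightarrow> complex^'m^'n" where
  "cmat A = (\<chi> i j. complex_of_real (A $ i $ j))"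

lemma cmat_mult: "cmat (A ** B) = cmat A ** cmat B"
  by (simp add: cmat_def matrix_matrix_mult_def vec_eq_iff)

lemma cmat_add: "cmat (A + B) = cmat A + cmat B"
  by (simp add: cmat_def vec_eq_iff)

lemma cmat_of_real_vec:
  "cmat A *v (\<chi> i. complex_of_real (v $ i)) = (\<chi> i. complex_of_real ((A *v v) $ i))"
  by (simp add: cmat_def matrix_vector_mult_def vec_eq_iff)

text \<open>The pencil \<open>D - \<nu> K\<close> is nonsingular for every complex \<open>\<nu>\<close> in the closed unit disc. The value
  \<open>\<nu> = 0\<close> gives invertibility of \<open>D\<close>; the others say that \<open>D\<^sup>-\<^sup>1 K\<close> has no eigenvalue
  \<open>\<mu> = 1 / \<nu>\<close> outside the open unit disc.\<close>

definition pencil_regular :: "real^'n::finite^'n \<Rightarrow> real^'n^'n \<Rightarrow> bool" where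
  "pencil_regular D K \<longleftrightarrow>
     (\<forall>\<nu> v. cmod \<nu> \<le> 1 \<longrightarrow> cmat D *v v = \<nu> *s (cmat K *v v) \<longrightarrow> v = 0)"

lemma pencil_regular_imp_spectral_radius:
  fixes D K :: "real^'n::finite^'n"
  assumes reg: "pencil_regular D K"
  shows "invertible D \<and> spectral_radius (matrix_inv D ** K) < 1"
proof
  have "v = 0" if "D *v v = 0" for v
  proof -
    have "cmat D *v (\<chi> i. complex_of_real (v $ i)) = 0"
      by (simp add: cmat_of_real_vec that vec_eq_iff)
    then have "(\<chi> i. complex_of_real (v $ i)) = 0"
      using reg[unfolded pencil_regular_def, rule_format, of 0] by simp
    then show ?thesis by (simp add: vec_eq_iff)
  qed
  then show inv: "invertible D"
    by (metis invertible_left_inverse matrix_left_invertible_ker)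
  define A where "A = matrix_inv D ** K"
  have DA: "D ** A = K"
    using someI_ex[OF inv[unfolded invertible_def]]
    by (simp add: A_def matrix_mul_assoc flip: matrix_inv_def)
  let ?E = "{\<mu>. \<exists>v. v \<noteq> 0 \<and> cmat A *v v = \<mu> *s v}"
  have "cmod \<mu> < 1" if "\<mu> \<in> ?E" for \<mu>
  proof (rule ccontr)
    assume "\<not> cmod \<mu> < 1"
    then have ge: "cmod \<mu> \<ge> 1" by simp
    from that obtain v where v: "v \<noteq> 0" "cmat A *v v = \<mu> *s v" by blast
    have "cmat K *v v = cmat D *v (cmat A *v v)"
      by (simp add: DA[symmetric] cmat_mult matrix_vector_mul_assoc)
    also have "\<dots> = \<mu> *s (cmat D *v v)"
      by (simp only: v(2) vector_scalar_commute)
    moreover have "\<mu> \<noteq> 0" using ge by auto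
    ultimately have "cmat D *v v = inverse \<mu> *s (cmat K *v v)"
      by (simp add: vec_eq_iff)
    moreover have "cmod (inverse \<mu>) \<le> 1"
      using ge by (simp add: norm_inverse inverse_le_1_iff)
    ultimately show False using reg v(1) unfolding pencil_regular_def by blast
  qed
  moreover have "spectral_radius A = Max (cmod ` ?E)"
    unfolding spectral_radius_def cmat_def by (rule arg_cong[of _ _ Max]) auto
  ultimately show "spectral_radius (matrix_inv D ** K) < 1"
    using eigenvalues_finite_nonempty[of "cmat A"] unfolding A_def[symmetric] by simp
qed

text \<open>Regularity is an open condition on \<open>D\<close>: the norm of \<open>(D - \<nu> K) v\<close> has a positive minimum over
  the compact set of all \<open>\<nu>\<close> in the disc and all unit vectors \<open>v\<close>.\<close>

lemma pencil_regular_perturb: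
  fixes D K :: "real^'n::finite^'n"
  assumes reg: "pencil_regular D K"
  shows "\<exists>c>0. \<forall>E. (\<forall>p q. \<bar>E $ p $ q\<bar> < c) \<longrightarrow> pencil_regular (D + E) K"
proof -
  let ?g = "\<lambda>z :: complex \<times> (complex^'n). norm (cmat D *v snd z - fst z *s (cmat K *v snd z))"
  let ?S = "cball (0::complex) 1 \<times> sphere (0 :: complex^'n) 1"
  have cont: "continuous_on ?S ?g"
    unfolding matrix_vector_mult_def vector_scalar_mult_def
    by (intro continuous_intros)
  have ne: "?S \<noteq> {}" by simp
  obtain z0 where z0: "z0 \<in> ?S" "\<forall>z\<in>?S. ?g z0 \<le> ?g z"
    using continuous_attains_inf[OF compact_Times[OF compact_cball compact_sphere] ne cont] by blast
  define m where "m = ?g z0"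
  have "m > 0"
  proof (rule ccontr)
    assume "\<not> m > 0"
    then have "cmat D *v snd z0 = fst z0 *s (cmat K *v snd z0)" by (simp add: m_def)
    moreover have "cmod (fst z0) \<le> 1" "norm (snd z0) = 1" using z0(1) by auto
    ultimately show False using reg unfolding pencil_regular_def by force
  qed
  let ?n = "real CARD('n)"
  define c where "c = m / (?n * ?n)"
  have "c > 0" using \<open>m > 0\<close> by (simp add: c_def)
  moreover have "pencil_regular (D + E) K" if E: "\<forall>p q. \<bar>E $ p $ q\<bar> < c" for E
    unfolding pencil_regular_def
  proof (intro allI impI, rule ccontr)
    fix \<nu> :: complex and v :: "complex^'n"
    assume \<nu>: "cmod \<nu> \<le> 1" and eq: "cmat (D + E) *v v = \<nu> *s (cmat K *v v)" and "v \<noteq> 0"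
    define w where "w = inverse (norm v) *\<^sub>R v"
    have w: "norm w = 1" using \<open>v \<noteq> 0\<close> by (simp add: w_def)
    have "cmat (D + E) *v w = \<nu> *s (cmat K *v w)"
    proof -
      have "w = complex_of_real (inverse (norm v)) *s v"
        unfolding w_def vec_eq_iff by (simp add: scaleR_conv_of_real[where 'a=complex])
      then show ?thesis by (simp only: vector_scalar_commute eq) (simp add: vec_eq_iff)
    qed
    then have e: "cmat D *v w - \<nu> *s (cmat K *v w) = - (cmat E *v w)"
      by (simp add: cmat_add matrix_vector_mult_add_rdistrib algebra_simps)
    have "m \<le> ?g (\<nu>, w)" unfolding m_def by (rule z0(2)[rule_format]) (simp add: \<nu> w)
    also have "\<dots> = norm (cmat E *v w)" using e by simp
    also have "\<dots> \<le> (\<Sum>p\<in>UNIV. cmod ((cmat E *v w) $ p))" by (simp add: norm_vec_def L2_set_le_sum)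
    also have "\<dots> < (\<Sum>p\<in>(UNIV::'n set). ?n * c)"
    proof (rule sum_strict_mono)
      fix p
      have "cmod ((cmat E *v w) $ p) \<le> (\<Sum>q\<in>UNIV. cmod (of_real (E $ p $ q) * w $ q))"
        unfolding matrix_vector_mult_def cmat_def by (simp add: sum_norm_le)
      also have "\<dots> < (\<Sum>q\<in>(UNIV::'n set). c)"
      proof (rule sum_strict_mono)
        fix q
        have "cmod (of_real (E $ p $ q) * w $ q) \<le> \<bar>E $ p $ q\<bar> * 1"
          unfolding norm_mult norm_of_real
          using Finite_Cartesian_Product.norm_nth_le[of w q] w by (intro mult_left_mono) auto
        then show "cmod (of_real (E $ p $ q) * w $ q) < c" using E[rule_format, of p q] by simp
      qed auto
      finally show "cmod ((cmat E *v w) $ p) < ?n * c" by simp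
    qed auto
    also have "\<dots> = m" by (simp add: c_def)
    finally show False by simp
  qed
  ultimately show ?thesis by blast
qed

section \<open>The block structure of the iteration matrices\<close>

lemma cmat_mat_1: "cmat (mat 1) = mat 1"
  by (simp add: cmat_def mat_def vec_eq_iff)

lemma invertible_cmat:
  fixes A :: "real^'n::finite^'n"
  assumes "invertible A" and "cmat A *v v = 0"
  shows "v = 0"
  using assms cmat_mult cmat_mat_1
  by (metis invertible_left_inverse matrix_left_invertible_ker)

lemma block_cases:
  obtains (x) a where "p = Inl a" | (u) b where "p = Inr (Inl b)" | (lam) c where "p = Inr (Inr c)"
  by (metis sum.exhaust)

lemma sum_UNIV_blocks:
  fixes g :: "'x::finite + 'u::finite + 'x \<Rightarrow> 'a::comm_monoid_add"
  shows "(\<Sum>q\<in>UNIV. g q)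
    = (\<Sum>a\<in>UNIV. g (Inl a)) + ((\<Sum>b\<in>UNIV. g (Inr (Inl b))) + (\<Sum>c\<in>UNIV. g (Inr (Inr c))))"
  by (simp add: UNIV_Plus_UNIV[symmetric] sum.Plus comp_def del: UNIV_Plus_UNIV)

lemma cmat_block_diag:
  "(cmat (block_diag A) *v v) $ (i, p) = (\<Sum>q\<in>UNIV. of_real (A i $ p $ q) * v $ (i, q))"
proof -
  have "(cmat (block_diag A) *v v) $ (i, p)
      = (\<Sum>(j, q)\<in>UNIV \<times> UNIV. if i = j then of_real (A i $ p $ q) * v $ (j, q) else 0)"
    unfolding cmat_def matrix_vector_mult_def block_diag_def
    by (auto intro!: sum.cong)
  also have "\<dots> = (\<Sum>j\<in>UNIV. \<Sum>q\<in>UNIV. if i = j then of_real (A i $ p $ q) * v $ (j, q) else 0)"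
    by (simp only: sum.cartesian_product)
  also have "\<dots> = (\<Sum>j\<in>UNIV. if i = j then \<Sum>q\<in>UNIV. of_real (A i $ p $ q) * v $ (j, q) else 0)"
    by (intro sum.cong refl) auto
  finally show ?thesis unfolding sum.delta'[OF finite] by simp
qed

lemma block3_nth:
  "block3 A11 A12 A13 A21 A22 A23 A31 A32 A33 $ Inl a $ Inl a' = A11 $ a $ a'"
  "block3 A11 A12 A13 A21 A22 A23 A31 A32 A33 $ Inl a $ Inr (Inl b') = A12 $ a $ b'"
  "block3 A11 A12 A13 A21 A22 A23 A31 A32 A33 $ Inl a $ Inr (Inr c') = A13 $ a $ c'"
  "block3 A11 A12 A13 A21 A22 A23 A31 A32 A33 $ Inr (Inl b) $ Inl a' = A21 $ b $ a'"
  "block3 A11 A12 A13 A21 A22 A23 A31 A32 A33 $ Inr (Inl b) $ Inr (Inl b') = A22 $ b $ b'"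
  "block3 A11 A12 A13 A21 A22 A23 A31 A32 A33 $ Inr (Inl b) $ Inr (Inr c') = A23 $ b $ c'"
  "block3 A11 A12 A13 A21 A22 A23 A31 A32 A33 $ Inr (Inr c) $ Inl a' = A31 $ c $ a'"
  "block3 A11 A12 A13 A21 A22 A23 A31 A32 A33 $ Inr (Inr c) $ Inr (Inl b') = A32 $ c $ b'"
  "block3 A11 A12 A13 A21 A22 A23 A31 A32 A33 $ Inr (Inr c) $ Inr (Inr c') = A33 $ c $ c'"
  by (simp_all add: block3_def stack3_def)

lemma stage_eq_iff: "stage i = stage j \<longleftrightarrow> i = j" for i j :: "'n::{finite,linorder}"
  using stage_bij[where 'n='n] by (auto simp: bij_betw_def inj_on_def)

lemma stage_range: "stage i \<in> {1..CARD('n)}" for i :: "'n::{finite,linorder}"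
  using stage_bij[where 'n='n] by (auto simp: bij_betw_def)

lemma stage_surj:
  assumes "k \<in> {1..CARD('n)}"
  obtains i :: "'n::{finite,linorder}" where "stage i = k"
  using assms stage_bij[where 'n='n] unfolding bij_betw_def by (metis imageE)

text \<open>\<open>L\<close> passes the state component on to the next stage and \<open>U\<close> passes the costate component back
  to the previous one. Each sum has at most one nonzero term; the lemmas that follow evaluate it.\<close>

lemma cmat_coupling:
  fixes v :: "complex^('n::{finite,linorder} \<times> ('x::finite + 'u::finite + 'x))"
  shows "(cmat (L_mat + U_mat) *v v) $ (i, Inl a)
      = (\<Sum>j\<in>UNIV. if stage i = stage j + 1 then v $ (j, Inl a) else 0)"
    and "(cmat (L_mat + U_mat) *v v) $ (i, Inr (Inl b)) = 0"
    and "(cmat (L_mat + U_mat) *v v) $ (i, Inr (Inr a))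
      = (\<Sum>j\<in>UNIV. if stage j = stage i + 1 then v $ (j, Inr (Inr a)) else 0)"
proof -
  have *: "(cmat (L_mat + U_mat) *v v) $ (i, p) = (\<Sum>j\<in>UNIV. \<Sum>q\<in>UNIV.
      of_real ((if stage i = stage j + 1 then M_L $ p $ q else 0)
             + (if stage j = stage i + 1 then M_U $ p $ q else 0)) * v $ (j, q))" for p
    unfolding cmat_def matrix_vector_mult_def L_mat_def U_mat_def
    by (auto simp: sum.cartesian_product intro!: sum.cong)
  show "(cmat (L_mat + U_mat) *v v) $ (i, Inl a)
      = (\<Sum>j\<in>UNIV. if stage i = stage j + 1 then v $ (j, Inl a) else 0)"
    unfolding * sum_UNIV_blocks M_L_def M_U_def block3_nth
    by (intro sum.cong refl)
      (simp add: mat_def if_distrib[of "\<lambda>x. x * _"] if_distrib[of of_real] cong: if_cong)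
  show "(cmat (L_mat + U_mat) *v v) $ (i, Inr (Inl b)) = 0"
    unfolding * sum_UNIV_blocks M_L_def M_U_def block3_nth
    by (simp cong: if_cong)
  show "(cmat (L_mat + U_mat) *v v) $ (i, Inr (Inr a))
      = (\<Sum>j\<in>UNIV. if stage j = stage i + 1 then v $ (j, Inr (Inr a)) else 0)"
    unfolding * sum_UNIV_blocks M_L_def M_U_def block3_nth
    by (intro sum.cong refl)
      (simp add: mat_def if_distrib[of "\<lambda>x. x * _"] if_distrib[of of_real] cong: if_cong)
qed

lemma coupling_x_first:
  fixes v :: "complex^('n::{finite,linorder} \<times> ('x::finite + 'u::finite + 'x))"
  assumes "stage i = 1"
  shows "(cmat (L_mat + U_mat) *v v) $ (i, Inl a) = 0"
proof -
  have "stage i \<noteq> stage j + 1" for j :: 'n using assms stage_range[of j] by auto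
  then show ?thesis unfolding cmat_coupling by simp
qed

lemma coupling_x_Suc:
  fixes v :: "complex^('n::{finite,linorder} \<times> ('x::finite + 'u::finite + 'x))"
  assumes "stage i = stage j + 1"
  shows "(cmat (L_mat + U_mat) *v v) $ (i, Inl a) = v $ (j, Inl a)"
proof -
  have "stage i = stage j' + 1 \<longleftrightarrow> j' = j" for j' :: 'n using assms by (auto simp: stage_eq_iff)
  then show ?thesis unfolding cmat_coupling by simp
qed

lemma coupling_lam_last:
  fixes v :: "complex^('n::{finite,linorder} \<times> ('x::finite + 'u::finite + 'x))"
  assumes "stage i = CARD('n)"
  shows "(cmat (L_mat + U_mat) *v v) $ (i, Inr (Inr a)) = 0"
proof -
  have "stage j \<noteq> stage i + 1" for j :: 'n using assms stage_range[of j] by auto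
  then show ?thesis unfolding cmat_coupling by simp
qed

lemma coupling_lam_Suc:
  fixes v :: "complex^('n::{finite,linorder} \<times> ('x::finite + 'u::finite + 'x))"
  assumes "stage j = stage i + 1"
  shows "(cmat (L_mat + U_mat) *v v) $ (i, Inr (Inr a)) = v $ (j, Inr (Inr a))"
proof -
  have "stage j' = stage i + 1 \<longleftrightarrow> j' = j" for j' :: 'n using assms by (metis stage_eq_iff)
  then show ?thesis unfolding cmat_coupling by simp
qed

lemma stage_forward_induct [case_names first Suc]:
  fixes i :: "'n::{finite,linorder}"
  assumes "\<And>i. stage i = 1 \<Longrightarrow> Q i"
    and "\<And>i j. stage i = stage j + 1 \<Longrightarrow> Q j \<Longrightarrow> Q i"
  shows "Q i"
proof (induction "stage i" arbitrary: i rule: less_induct)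
  case less
  show ?case
  proof (cases "stage i = 1")
    case False
    with stage_range[of i] have "stage i - 1 \<in> {1..CARD('n)}" by auto
    then obtain j :: 'n where "stage j = stage i - 1" by (rule stage_surj)
    with False stage_range[of i] have "stage i = stage j + 1" by auto
    then show ?thesis using assms(2) less by fastforce
  qed (rule assms(1))
qed

lemma stage_backward_induct [case_names last Suc]:
  fixes i :: "'n::{finite,linorder}"
  assumes "\<And>i :: 'n. stage i = CARD('n) \<Longrightarrow> Q i"
    and "\<And>i j. stage j = stage i + 1 \<Longrightarrow> Q j \<Longrightarrow> Q i"
  shows "Q i"
proof (induction "CARD('n) - stage i" arbitrary: i rule: less_induct)
  case less
  show ?case
  proof (cases "stage i = CARD('n)")
    case False
    with stage_range[of i] have "stage i + 1 \<in> {1..CARD('n)}" by auto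
    then obtain j :: 'n where j: "stage j = stage i + 1" by (rule stage_surj)
    then have "CARD('n) - stage j < CARD('n) - stage i" using stage_range[of j] by auto
    then show ?thesis using assms(2) j less by blast
  qed (rule assms(1))
qed

section \<open>Two criteria for regularity\<close>

text \<open>If an invertible \<open>A\<close> maps the space of vectors with costate component only into itself, then it
  maps it onto itself, so that space is also its own preimage. This replaces a computation with the
  inverses of the three diagonal blocks.\<close>

lemma costate_invariant_preimage:
  fixes A :: "real^('x::finite + 'u::finite + 'x)^('x + 'u + 'x)"
  assumes inv: "invertible A"
    and A1: "\<And>a c. A $ Inl a $ Inr (Inr c) = 0"
    and A2: "\<And>b c. A $ Inr (Inl b) $ Inr (Inr c) = 0"
    and s1: "\<And>a. (cmat A *v s) $ Inl a = 0"
    and s2: "\<And>b. (cmat A *v s) $ Inr (Inl b) = 0"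
  shows "s $ Inl a = 0 \<and> s $ Inr (Inl b) = 0"
proof -
  define emb :: "complex^'x \<Rightarrow> complex^('x + 'u + 'x)" where
    "emb l = (\<chi> p. case p of Inl a \<Rightarrow> 0 | Inr (Inl b) \<Rightarrow> 0 | Inr (Inr c) \<Rightarrow> l $ c)" for l
  define A33 :: "complex^'x^'x" where
    "A33 = (\<chi> a c. of_real (A $ Inr (Inr a) $ Inr (Inr c)))"
  have emb: "cmat A *v emb l = emb (A33 *v l)" for l
    unfolding vec_eq_iff emb_def A33_def cmat_def matrix_vector_mult_def
    by (auto simp: sum_UNIV_blocks A1 A2 split: sum.splits)
  have emb0: "emb l = 0 \<longleftrightarrow> l = 0" for l
    by (auto simp: emb_def vec_eq_iff split: sum.splits)
  have "l = 0" if "A33 *v l = 0" for l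
    using invertible_cmat[OF inv, of "emb l"] emb emb0 that by simp
  then obtain B where "A33 ** B = mat 1"
    by (metis matrix_left_invertible_ker matrix_left_right_inverse)
  then obtain l where l: "A33 *v l = (\<chi> c. (cmat A *v s) $ Inr (Inr c))"
    by (metis matrix_right_invertible_surjective surjD)
  have "cmat A *v emb l = cmat A *v s"
    unfolding emb l by (auto simp: vec_eq_iff emb_def s1 s2 split: sum.splits)
  then have "cmat A *v (s - emb l) = 0" by (simp add: matrix_vector_mult_diff_distrib)
  then have "s = emb l" using invertible_cmat[OF inv] by fastforce
  then show ?thesis by (simp add: emb_def)
qed

text \<open>If the costate does not enter the first two block rows, the matrix \<open>D\<^sup>-\<^sup>1 (L + U)\<close> is
  nilpotent: states and inputs vanish by a forward sweep over the stages, and then the costates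
  vanish by a backward sweep.\<close>

lemma pencil_regular_block_triangular:
  fixes A :: "'n::{finite,linorder} \<Rightarrow> real^('x::finite + 'u::finite + 'x)^('x + 'u + 'x)"
  assumes inv: "\<And>i. invertible (A i)"
    and A1: "\<And>i a c. A i $ Inl a $ Inr (Inr c) = 0"
    and A2: "\<And>i b c. A i $ Inr (Inl b) $ Inr (Inr c) = 0"
  shows "pencil_regular (block_diag A) (L_mat + U_mat)"
  unfolding pencil_regular_def
proof (intro allI impI)
  fix \<nu> and v :: "complex^('n \<times> ('x + 'u + 'x))"
  assume eq: "cmat (block_diag A) *v v = \<nu> *s (cmat (L_mat + U_mat) *v v)"
  define s where "s i = (\<chi> q. v $ (i, q))" for i
  have row: "(cmat (A i) *v s i) $ p = \<nu> * (cmat (L_mat + U_mat) *v v) $ (i, p)" for i p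
  proof -
    have "(cmat (A i) *v s i) $ p = (cmat (block_diag A) *v v) $ (i, p)"
      unfolding cmat_block_diag by (simp add: cmat_def s_def matrix_vector_mult_def)
    then show ?thesis by (simp add: eq)
  qed
  have xu: "\<forall>a b. v $ (i, Inl a) = 0 \<and> v $ (i, Inr (Inl b)) = 0" for i
  proof (induction i rule: stage_forward_induct)
    case (first i)
    then show ?case
      using costate_invariant_preimage[OF inv A1 A2, of i "s i"]
      by (simp add: row cmat_coupling(2) coupling_x_first) (simp add: s_def)
  next
    case (Suc i j)
    then show ?case
      using costate_invariant_preimage[OF inv A1 A2, of i "s i"]
      by (simp add: row cmat_coupling(2) coupling_x_Suc) (simp add: s_def)
  qed
  have x: "(cmat (L_mat + U_mat) *v v) $ (i, Inl a) = 0" for i a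
    unfolding cmat_coupling using xu by (intro sum.neutral) auto
  have lam: "s i = 0" for i
  proof (induction i rule: stage_backward_induct)
    case (last i)
    have "(cmat (L_mat + U_mat) *v v) $ (i, p) = 0" for p
      using last x cmat_coupling(2)[of v] coupling_lam_last[of i v]
      by (cases p rule: block_cases) auto
    then have "cmat (A i) *v s i = 0" unfolding vec_eq_iff row by simp
    then show ?case by (rule invertible_cmat[OF inv])
  next
    case (Suc i j)
    then have "v $ (j, Inr (Inr a)) = 0" for a by (simp add: s_def vec_eq_iff)
    then have "(cmat (L_mat + U_mat) *v v) $ (i, p) = 0" for p
      using x cmat_coupling(2)[of v] coupling_lam_Suc[OF Suc(1), of v]
      by (cases p rule: block_cases) auto
    then have "cmat (A i) *v s i = 0" unfolding vec_eq_iff row by simp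
    then show ?case by (rule invertible_cmat[OF inv])
  qed
  show "v = 0"
    using lam by (auto simp: s_def vec_eq_iff)
qed

text \<open>The two sweeps over the stages, made quantitative for blocks that are entrywise \<open>e\<close>-close to diagonal
  matrices. If \<open>m\<close> is the largest modulus of a component of \<open>v\<close>, then every row is perturbed by at
  most \<open>k m\<close> with \<open>k = e CARD('x + 'u + 'x)\<close>, a stage adds at most this amount to the state and to the
  costate, and the input is at most \<open>k m / \<gamma>\<close>. Hence all components are smaller than \<open>m\<close>. The
  diagonal entries of the input block are bounded only from below.\<close>

lemma pencil_regular_diag_dominant:
  fixes A :: "'n::{finite,linorder} \<Rightarrow> real^('x::finite + 'u::finite + 'x)^('x + 'u + 'x)"
    and d :: "'n \<Rightarrow> ('x + 'u + 'x) \<Rightarrow> real"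
  assumes E: "\<And>i p q. \<bar>A i $ p $ q - (if p = q then d i p else 0)\<bar> \<le> e"
    and dx: "\<And>i a. d i (Inl a) = -1" and dl: "\<And>i a. d i (Inr (Inr a)) = -1"
    and du: "\<And>i b. d i (Inr (Inl b)) \<ge> \<gamma>"
    and e1: "real CARD('n) * (e * CARD('x + 'u + 'x)) < 1"
    and e2: "e * CARD('x + 'u + 'x) < \<gamma>"
  shows "pencil_regular (block_diag A) (L_mat + U_mat)"
  unfolding pencil_regular_def
proof (intro allI impI, rule ccontr)
  fix \<nu> and v :: "complex^('n \<times> ('x + 'u + 'x))"
  assume \<nu>: "cmod \<nu> \<le> 1" and eq: "cmat (block_diag A) *v v = \<nu> *s (cmat (L_mat + U_mat) *v v)"
    and "v \<noteq> 0"
  define r where "r i p = cmod ((cmat (L_mat + U_mat) *v v) $ (i, p))" for i p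
  define m where "m = Max (range (\<lambda>q. cmod (v $ q)))"
  have m: "cmod (v $ q) \<le> m" for q unfolding m_def by (intro Max_ge) auto
  have "m \<in> range (\<lambda>q. cmod (v $ q))" unfolding m_def by (intro Max_in) auto
  then obtain i0 p0 where attained: "m = cmod (v $ (i0, p0))" by auto
  obtain q0 where "v $ q0 \<noteq> 0" using \<open>v \<noteq> 0\<close> by (auto simp: vec_eq_iff)
  with m[of q0] have "m > 0" using zero_less_norm_iff[of "v $ q0"] by linarith
  have "e \<ge> 0" using E[of undefined undefined undefined] by linarith
  define k where "k = e * CARD('x + 'u + 'x)"
  have "k \<ge> 0" using \<open>e \<ge> 0\<close> by (simp add: k_def)
  have row: "\<bar>d i p\<bar> * cmod (v $ (i, p)) \<le> r i p + k * m" for i p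
  proof -
    let ?F = "\<lambda>q. complex_of_real (A i $ p $ q - (if p = q then d i p else 0)) * v $ (i, q)"
    have "(cmat (block_diag A) *v v) $ (i, p) = of_real (d i p) * v $ (i, p) + (\<Sum>q\<in>UNIV. ?F q)"
      unfolding cmat_block_diag
      by (simp add: left_diff_distrib sum_subtractf if_distrib[of of_real]
          if_distrib[of "\<lambda>x. x * _"] cong: if_cong)
    then have *: "of_real (d i p) * v $ (i, p)
        = \<nu> * (cmat (L_mat + U_mat) *v v) $ (i, p) - (\<Sum>q\<in>UNIV. ?F q)"
      by (simp add: eq algebra_simps)
    have "\<bar>d i p\<bar> * cmod (v $ (i, p)) = cmod (of_real (d i p) * v $ (i, p))"
      by (simp add: norm_mult)
    also have "\<dots> \<le> cmod \<nu> * r i p + cmod (\<Sum>q\<in>UNIV. ?F q)"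
      unfolding * r_def norm_mult[symmetric] by (rule norm_triangle_ineq4)
    also have "cmod (\<Sum>q\<in>UNIV. ?F q) \<le> (\<Sum>q\<in>(UNIV :: ('x + 'u + 'x) set). e * m)"
    proof (rule sum_norm_le)
      fix q
      show "cmod (?F q) \<le> e * m"
        unfolding norm_mult norm_of_real by (intro mult_mono E m) (use \<open>e \<ge> 0\<close> in auto)
    qed
    also have "\<dots> = k * m" by (simp add: k_def)
    also have "cmod \<nu> * r i p \<le> r i p"
      using mult_right_mono[OF \<nu>, of "r i p"] by (simp add: r_def)
    finally show ?thesis by simp
  qed
  have x: "\<forall>a. cmod (v $ (i, Inl a)) \<le> real (stage i) * (k * m)" for i
  proof (induction i rule: stage_forward_induct)
    case (first i)
    show ?case
      using row[of i "Inl _"] first by (auto simp: dx r_def coupling_x_first)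
  next
    case (Suc i j)
    show ?case
    proof
      fix a
      have "cmod (v $ (i, Inl a)) \<le> cmod (v $ (j, Inl a)) + k * m"
        using row[of i "Inl a"] Suc(1) by (simp add: dx r_def coupling_x_Suc)
      also have "\<dots> \<le> real (stage i) * (k * m)"
        using Suc by (simp add: algebra_simps)
      finally show "cmod (v $ (i, Inl a)) \<le> real (stage i) * (k * m)" .
    qed
  qed
  have lam: "\<forall>a. cmod (v $ (i, Inr (Inr a))) \<le> real (CARD('n) + 1 - stage i) * (k * m)" for i
  proof (induction i rule: stage_backward_induct)
    case (last i)
    show ?case
      using row[of i "Inr (Inr _)"] last by (auto simp: dl r_def coupling_lam_last)
  next
    case (Suc i j)
    show ?case
    proof
      fix a
      have "cmod (v $ (i, Inr (Inr a))) \<le> cmod (v $ (j, Inr (Inr a))) + k * m"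
        using row[of i "Inr (Inr a)"] Suc(1) by (simp add: dl r_def coupling_lam_Suc)
      also have "\<dots> \<le> (real (CARD('n) + 1 - stage j) + 1) * (k * m)"
        using Suc by (simp add: algebra_simps)
      also have "real (CARD('n) + 1 - stage j) + 1 = real (CARD('n) + 1 - stage i)"
        using Suc(1) stage_range[of j] by (simp add: of_nat_diff)
      finally show "cmod (v $ (i, Inr (Inr a))) \<le> real (CARD('n) + 1 - stage i) * (k * m)" .
    qed
  qed
  have Nk: "real n * (k * m) < m" if "n \<le> CARD('n)" for n
  proof -
    have "real n * (k * m) \<le> real CARD('n) * (k * m)"
      using that \<open>k \<ge> 0\<close> \<open>m > 0\<close> by (intro mult_right_mono) auto
    also have "\<dots> = real CARD('n) * k * m" by simp
    also have "\<dots> < 1 * m"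
      using e1 \<open>m > 0\<close> unfolding k_def[symmetric] by (intro mult_strict_right_mono)
    finally show ?thesis by simp
  qed
  have "cmod (v $ (i0, p0)) < m"
  proof (cases p0)
    case (Inl a)
    have "real (stage i0) * (k * m) < m" using stage_range[of i0] by (intro Nk) auto
    then show ?thesis using x[rule_format, of i0 a] Inl by simp
  next
    case p0: (Inr p')
    show ?thesis
    proof (cases p')
      case (Inl b)
      have "\<gamma> * cmod (v $ (i0, p0)) \<le> \<bar>d i0 p0\<bar> * cmod (v $ (i0, p0))"
        using du[of i0 b] p0 Inl by (intro mult_right_mono) auto
      also have "\<dots> \<le> k * m"
        using row[of i0 p0] p0 Inl by (simp add: r_def cmat_coupling)
      also have "\<dots> < \<gamma> * m" using e2 \<open>m > 0\<close> unfolding k_def by (intro mult_strict_right_mono)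
      finally show ?thesis using \<open>k \<ge> 0\<close> e2 unfolding k_def[symmetric] by simp
    next
      case (Inr a)
      have "real (CARD('n) + 1 - stage i0) * (k * m) < m" using stage_range[of i0] by (intro Nk) auto
      then show ?thesis using lam[rule_format, of i0 a] p0 Inr by simp
    qed
  qed
  with attained show False by simp
qed

section \<open>Second derivatives of the Hamiltonian\<close>

lemma twice_continuously_differentiable_imp_twice_differentiable:
  "twice_continuously_differentiable F \<Longrightarrow> twice_differentiable F"
  unfolding twice_continuously_differentiable_def twice_differentiable_def differentiable_def
  by blast

text \<open>The second derivative of the barrier at \<open>z = (u, x)\<close> as a bilinear form. Every constraint is
  affine with linear part \<open>G_lin\<close>, so only the second derivative of the logarithm contributes.\<close>

definition barrier_hess ::
    "('u::finite, 'x::finite) nmpc \<Rightarrow> (real^'u) \<times> (real^'x) \<Rightarrow> (real^'u) \<times> (real^'x) \<Rightarrow>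
     (real^'u) \<times> (real^'x) \<Rightarrow> real" where
  "barrier_hess P z w w' =
     bar_par P * (\<Sum>j\<in>UNIV. G_lin w $ j * G_lin w' $ j / (G P (fst z) (snd z) $ j)\<^sup>2)"

text \<open>The second derivative of the Hamiltonian with respect to \<open>z = (u, x)\<close>, where \<open>C2\<close> and \<open>F2\<close> are
  the second derivatives of the cost and of the dynamics; \<open>w'\<close> is the direction in which the
  first derivative along \<open>w\<close> is differentiated.\<close>

definition ham_hess where
  "ham_hess P C2 F2 z lam w w' =
     blinfun_apply (blinfun_apply (C2 z) w') w + barrier_hess P z w w'
     + lam \<bullet> blinfun_apply (blinfun_apply (F2 z) w') w"

lemma G_line: "G P (fst (z + t *\<^sub>R w)) (snd (z + t *\<^sub>R w)) $ j = G P (fst z) (snd z) $ j + t * G_lin w $ j"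
  by (auto simp: G_def G_lin_def algebra_simps split: sum.splits)

lemma ham_dir_line:
  fixes P :: "('u::finite, 'x::finite) nmpc"
  assumes F2: "(F has_derivative blinfun_apply (F2 z)) (at z)"
    and C2: "(C has_derivative blinfun_apply (C2 z)) (at z)"
    and pos: "\<And>j. G P (fst z) (snd z) $ j > 0"
  shows "((\<lambda>t. ham_dir P C F (z + t *\<^sub>R w') lam w) has_real_derivative
      ham_hess P C2 F2 z lam w w') (at 0)"
proof -
  have line: "((\<lambda>t. z + t *\<^sub>R w') has_derivative (\<lambda>t. t *\<^sub>R w')) (at 0)"
    by (auto intro!: derivative_eq_intros)
  have lift: "((\<lambda>t. blinfun_apply (H (z + t *\<^sub>R w')) w) has_derivative
      (\<lambda>t. t *\<^sub>R blinfun_apply (blinfun_apply (H2 z) w') w)) (at 0)"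
    if "(H has_derivative blinfun_apply (H2 z)) (at z)"
    for H :: "_ \<Rightarrow> _ \<Rightarrow>\<^sub>L 'c::real_normed_vector" and H2
  proof -
    have "((\<lambda>t. H (z + t *\<^sub>R w')) has_derivative (\<lambda>t. blinfun_apply (H2 z) (t *\<^sub>R w'))) (at 0)"
      by (rule has_derivative_compose[OF line]) (simp add: that)
    from bounded_linear.has_derivative[OF blinfun.bounded_linear_left this, of w]
    show ?thesis by (simp add: blinfun.scaleR_right blinfun.scaleR_left)
  qed
  have C: "((\<lambda>t. blinfun_apply (C (z + t *\<^sub>R w')) w) has_real_derivative
      blinfun_apply (blinfun_apply (C2 z) w') w) (at 0)"
    unfolding has_field_derivative_def
    by (rule has_derivative_eq_rhs[OF lift[of C C2, OF C2]]) (simp add: fun_eq_iff)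
  have F: "((\<lambda>t. lam \<bullet> blinfun_apply (F (z + t *\<^sub>R w')) w) has_real_derivative
      lam \<bullet> blinfun_apply (blinfun_apply (F2 z) w') w) (at 0)"
    unfolding has_field_derivative_def
    by (rule has_derivative_eq_rhs[OF has_derivative_inner_right[OF lift[of F F2, OF F2], of lam]])
      (simp add: fun_eq_iff)
  have B: "((\<lambda>t. \<Sum>j\<in>UNIV. G_lin w $ j / G P (fst (z + t *\<^sub>R w')) (snd (z + t *\<^sub>R w')) $ j)
      has_real_derivative
      (\<Sum>j\<in>UNIV. - (G_lin w $ j * G_lin w' $ j / (G P (fst z) (snd z) $ j)\<^sup>2))) (at 0)"
  proof (rule DERIV_sum)
    fix j
    show "((\<lambda>t. G_lin w $ j / G P (fst (z + t *\<^sub>R w')) (snd (z + t *\<^sub>R w')) $ j)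
      has_real_derivative - (G_lin w $ j * G_lin w' $ j / (G P (fst z) (snd z) $ j)\<^sup>2)) (at 0)"
      unfolding G_line using pos[of j]
      by (auto intro!: derivative_eq_intros simp: power2_eq_square)
  qed
  show ?thesis
    unfolding ham_dir_def ham_hess_def barrier_hess_def
    by (rule DERIV_cong[OF DERIV_add[OF DERIV_diff[OF C DERIV_cmult[OF B]] F]]) (simp add: sum_negf)
qed

lemma ham_grads_line:
  fixes P :: "('u::finite, 'x::finite) nmpc"
  assumes F: "\<forall>z. ((\<lambda>(u, x). dyn P u x) has_derivative blinfun_apply (F z)) (at z)"
    and C: "\<forall>z. ((\<lambda>(u, x). cost P i u x) has_derivative blinfun_apply (C z)) (at z)"
    and F2: "\<forall>z. (F has_derivative blinfun_apply (F2 z)) (at z)"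
    and C2: "\<forall>z. (C has_derivative blinfun_apply (C2 z)) (at z)"
    and pos: "\<forall>j. G P u x $ j > 0"
  shows "((\<lambda>t. ham_u P i (u + t *\<^sub>R v) (x + t *\<^sub>R y) lam $ b) has_real_derivative
      ham_hess P C2 F2 (u, x) lam (axis b 1, 0) (v, y)) (at 0)"
    and "((\<lambda>t. ham_x P i (u + t *\<^sub>R v) (x + t *\<^sub>R y) lam $ a) has_real_derivative
      ham_hess P C2 F2 (u, x) lam (0, axis a 1) (v, y)) (at 0)"
proof -
  have line: "((\<lambda>t. ham_dir P C F (u + t *\<^sub>R v, x + t *\<^sub>R y) lam w) has_real_derivative
      ham_hess P C2 F2 (u, x) lam w (v, y)) (at 0)" for w
    using ham_dir_line[of F F2 "(u, x)" C C2 P "(v, y)" lam w] F2 C2 pos by simp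
  have ev: "\<forall>\<^sub>F t in nhds 0. \<forall>j. G P (u + t *\<^sub>R v) (x + t *\<^sub>R y) $ j > 0"
  proof -
    have "((\<lambda>t. (u + t *\<^sub>R v, x + t *\<^sub>R y)) \<longlongrightarrow> (u + 0 *\<^sub>R v, x + 0 *\<^sub>R y)) (nhds 0)"
      by (intro tendsto_intros filterlim_ident)
    from topological_tendstoD[OF this G_pos_open[of P]] pos show ?thesis by simp
  qed
  have evu: "\<forall>\<^sub>F t in nhds 0. ham_u P i (u + t *\<^sub>R v) (x + t *\<^sub>R y) lam $ b
      = ham_dir P C F (u + t *\<^sub>R v, x + t *\<^sub>R y) lam (axis b 1, 0)"
    using ev by eventually_elim (rule ham_u_component[OF F C])
  have evx: "\<forall>\<^sub>F t in nhds 0. ham_x P i (u + t *\<^sub>R v) (x + t *\<^sub>R y) lam $ a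
      = ham_dir P C F (u + t *\<^sub>R v, x + t *\<^sub>R y) lam (0, axis a 1)"
    using ev by eventually_elim (rule ham_x_component[OF F C])
  show "((\<lambda>t. ham_u P i (u + t *\<^sub>R v) (x + t *\<^sub>R y) lam $ b) has_real_derivative
      ham_hess P C2 F2 (u, x) lam (axis b 1, 0) (v, y)) (at 0)"
    using line unfolding DERIV_cong_ev[OF refl evu refl] .
  show "((\<lambda>t. ham_x P i (u + t *\<^sub>R v) (x + t *\<^sub>R y) lam $ a) has_real_derivative
      ham_hess P C2 F2 (u, x) lam (0, axis a 1) (v, y)) (at 0)"
    using line unfolding DERIV_cong_ev[OF refl evx refl] .
qed

lemma ham_second_derivatives:
  fixes P :: "('u::finite, 'x::finite) nmpc"
  assumes F: "\<forall>z. ((\<lambda>(u, x). dyn P u x) has_derivative blinfun_apply (F z)) (at z)"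
    and C: "\<forall>z. ((\<lambda>(u, x). cost P i u x) has_derivative blinfun_apply (C z)) (at z)"
    and F2: "\<forall>z. (F has_derivative blinfun_apply (F2 z)) (at z)"
    and C2: "\<forall>z. (C has_derivative blinfun_apply (C2 z)) (at z)"
    and pos: "\<forall>j. G P u x $ j > 0"
  shows "jacobian (\<lambda>y. ham_u P i u y lam) (at x) $ b $ a
      = ham_hess P C2 F2 (u, x) lam (axis b 1, 0) (0, axis a 1)"
    and "jacobian (\<lambda>v. ham_u P i v x lam) (at u) $ b $ b'
      = ham_hess P C2 F2 (u, x) lam (axis b 1, 0) (axis b' 1, 0)"
    and "jacobian (\<lambda>y. ham_x P i u y lam) (at x) $ a $ a'
      = ham_hess P C2 F2 (u, x) lam (0, axis a 1) (0, axis a' 1)"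
    and "jacobian (\<lambda>v. ham_x P i v x lam) (at u) $ a $ b
      = ham_hess P C2 F2 (u, x) lam (0, axis a 1) (axis b 1, 0)"
proof -
  note line = ham_grads_line[OF F C F2 C2 pos]
  have td: "twice_differentiable (\<lambda>(u, x). dyn P u x)" "twice_differentiable (\<lambda>(u, x). cost P i u x)"
    unfolding twice_differentiable_def differentiable_def
    by (rule exI[of _ F], use F F2 in blast, rule exI[of _ C], use C C2 in blast)
  note jac = jacobian_line ham_grads_differentiable[OF td] differentiable_const differentiable_ident pos
  have "((\<lambda>t. ham_u P i u (x + t *\<^sub>R axis a 1) lam $ b) has_real_derivative
      jacobian (\<lambda>y. ham_u P i u y lam) (at x) $ b $ a) (at 0)" by (intro jac)
  then show "jacobian (\<lambda>y. ham_u P i u y lam) (at x) $ b $ a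
      = ham_hess P C2 F2 (u, x) lam (axis b 1, 0) (0, axis a 1)"
    using line(1)[of 0 "axis a 1" lam b] by (simp add: DERIV_unique)
  have "((\<lambda>t. ham_u P i (u + t *\<^sub>R axis b' 1) x lam $ b) has_real_derivative
      jacobian (\<lambda>v. ham_u P i v x lam) (at u) $ b $ b') (at 0)" by (intro jac)
  then show "jacobian (\<lambda>v. ham_u P i v x lam) (at u) $ b $ b'
      = ham_hess P C2 F2 (u, x) lam (axis b 1, 0) (axis b' 1, 0)"
    using line(1)[of "axis b' 1" 0 lam b] by (simp add: DERIV_unique)
  have "((\<lambda>t. ham_x P i u (x + t *\<^sub>R axis a' 1) lam $ a) has_real_derivative
      jacobian (\<lambda>y. ham_x P i u y lam) (at x) $ a $ a') (at 0)" by (intro jac)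
  then show "jacobian (\<lambda>y. ham_x P i u y lam) (at x) $ a $ a'
      = ham_hess P C2 F2 (u, x) lam (0, axis a 1) (0, axis a' 1)"
    using line(2)[of 0 "axis a' 1" lam a] by (simp add: DERIV_unique)
  have "((\<lambda>t. ham_x P i (u + t *\<^sub>R axis b 1) x lam $ a) has_real_derivative
      jacobian (\<lambda>v. ham_x P i v x lam) (at u) $ a $ b) (at 0)" by (intro jac)
  then show "jacobian (\<lambda>v. ham_x P i v x lam) (at u) $ a $ b
      = ham_hess P C2 F2 (u, x) lam (0, axis a 1) (axis b 1, 0)"
    using line(2)[of "axis b 1" 0 lam a] by (simp add: DERIV_unique)
qed

text \<open>A box constraint involves a single coordinate of \<open>u\<close> or \<open>x\<close>. Therefore the barrier contributes
  nothing to the mixed derivatives, and a nonnegative diagonal matrix to the derivatives with respect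
  to \<open>u\<close>. That matrix is unbounded near the boundary of the input box.\<close>

lemma barrier_hess_mixed:
  "barrier_hess P z (v, 0) (0, y) = 0" "barrier_hess P z (0, y) (v, 0) = 0"
  unfolding barrier_hess_def
  by (auto intro!: sum.neutral simp: G_lin_def split: sum.splits)

lemma barrier_hess_uu_off_diag:
  "b \<noteq> b' \<Longrightarrow> barrier_hess P z (axis b 1, 0) (axis b' 1, 0) = 0"
  unfolding barrier_hess_def
  by (auto intro!: sum.neutral simp: G_lin_def axis_def split: sum.splits)

lemma barrier_hess_nonneg: "bar_par P \<ge> 0 \<Longrightarrow> barrier_hess P z w w \<ge> 0"
  unfolding barrier_hess_def by (auto intro!: mult_nonneg_nonneg sum_nonneg)

lemma G_lin_x_axis_le: "\<bar>G_lin (0, axis a 1) $ j\<bar> \<le> 1"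
  by (auto simp: G_lin_def axis_def split: sum.splits)

lemma barrier_hess_xx_le:
  fixes P :: "('u::finite, 'x::finite) nmpc"
  assumes "bar_par P \<ge> 0" and "\<delta> > 0" and G: "\<And>k. G P (fst z) (snd z) $ Inr k \<ge> \<delta>"
  shows "\<bar>barrier_hess P z (0, axis a 1) (0, axis a' 1)\<bar>
    \<le> bar_par P * (CARD(('u + 'u) + ('x + 'x)) * (1 / \<delta>\<^sup>2))"
proof -
  let ?t = "\<lambda>j. G_lin (0, axis a 1) $ j * G_lin (0, axis a' 1) $ j / (G P (fst z) (snd z) $ j)\<^sup>2"
  have "\<bar>\<Sum>j\<in>UNIV. ?t j\<bar> \<le> (\<Sum>j\<in>(UNIV :: (('u + 'u) + ('x + 'x)) set). 1 / \<delta>\<^sup>2)"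
  proof (rule order_trans[OF sum_abs sum_mono])
    fix j :: "('u + 'u) + ('x + 'x)"
    show "\<bar>?t j\<bar> \<le> 1 / \<delta>\<^sup>2"
    proof (cases j)
      case (Inl k)
      then show ?thesis by (auto simp: G_lin_def split: sum.splits)
    next
      case (Inr k)
      have "\<bar>G_lin (0, axis a 1) $ j\<bar> * \<bar>G_lin (0, axis a' 1) $ j\<bar> \<le> 1 * 1"
        by (intro mult_mono G_lin_x_axis_le) auto
      moreover have "\<delta>\<^sup>2 \<le> (G P (fst z) (snd z) $ j)\<^sup>2"
        using G[of k] Inr \<open>\<delta> > 0\<close> by (intro power_mono) auto
      ultimately show ?thesis
        using \<open>\<delta> > 0\<close> by (auto simp: abs_mult intro!: frac_le)
    qed
  qed
  from mult_left_mono[OF this[unfolded sum_constant] assms(1)] show ?thesis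
    unfolding barrier_hess_def abs_mult abs_of_nonneg[OF assms(1)] .
qed

lemma barrier_grad_x_le:
  fixes P :: "('u::finite, 'x::finite) nmpc"
  assumes "bar_par P \<ge> 0" and "\<delta> > 0" and G: "\<And>k. G P u x $ Inr k \<ge> \<delta>"
  shows "\<bar>bar_par P * (\<Sum>j\<in>UNIV. G_lin (0, axis a 1) $ j / G P u x $ j)\<bar>
    \<le> bar_par P * (CARD(('u + 'u) + ('x + 'x)) * (1 / \<delta>))"
proof -
  let ?t = "\<lambda>j. G_lin (0, axis a 1) $ j / G P u x $ j"
  have "\<bar>\<Sum>j\<in>UNIV. ?t j\<bar> \<le> (\<Sum>j\<in>(UNIV :: (('u + 'u) + ('x + 'x)) set). 1 / \<delta>)"
  proof (rule order_trans[OF sum_abs sum_mono])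
    fix j :: "('u + 'u) + ('x + 'x)"
    show "\<bar>?t j\<bar> \<le> 1 / \<delta>"
    proof (cases j)
      case (Inl k)
      then show ?thesis using \<open>\<delta> > 0\<close> by (auto simp: G_lin_def split: sum.splits)
    next
      case (Inr k)
      then show ?thesis
        using G[of k] G_lin_x_axis_le[of a j] \<open>\<delta> > 0\<close> by (auto intro!: frac_le)
    qed
  qed
  from mult_left_mono[OF this[unfolded sum_constant] assms(1)] show ?thesis
    unfolding abs_mult abs_of_nonneg[OF assms(1)] .
qed

text \<open>The product of the closed input box and the closed state box.\<close>

definition feasible_box :: "('u::finite, 'x::finite) nmpc \<Rightarrow> ((real^'u) \<times> (real^'x)) set" where
  "feasible_box P = cbox (u_lo P) (u_up P) \<times> cbox (x_lo P) (x_up P)"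

lemma G_pos_imp_feasible:
  assumes "\<forall>j. G P u x $ j > 0"
  shows "(u, x) \<in> feasible_box P"
proof -
  have "u_lo P $ b \<le> u $ b \<and> u $ b \<le> u_up P $ b" for b
    using assms[rule_format, of "Inl (Inl b)"] assms[rule_format, of "Inl (Inr b)"]
    by (simp add: G_def)
  moreover have "x_lo P $ a \<le> x $ a \<and> x $ a \<le> x_up P $ a" for a
    using assms[rule_format, of "Inr (Inl a)"] assms[rule_format, of "Inr (Inr a)"]
    by (simp add: G_def)
  ultimately show ?thesis by (simp add: feasible_box_def mem_box_cart)
qed

lemma bounded_on_feasible_box:
  fixes H :: "(real^'u::finite) \<times> (real^'x::finite) \<Rightarrow> 'c::real_normed_vector"
  assumes "continuous_on UNIV H"
  shows "\<exists>M\<ge>0. \<forall>z\<in>feasible_box P. norm (H z) \<le> M"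
proof -
  have "compact (feasible_box P)"
    unfolding feasible_box_def by (intro compact_Times compact_cbox)
  then have "bounded (H ` feasible_box P)"
    using assms by (intro compact_imp_bounded compact_continuous_image continuous_on_subset[OF assms]) auto
  then obtain M where "\<forall>z\<in>feasible_box P. norm (H z) \<le> M" by (auto simp: bounded_iff)
  then have "\<forall>z\<in>feasible_box P. norm (H z) \<le> max M 0" by (meson max.coboundedI1)
  then show ?thesis by (intro exI[of _ "max M 0"]) auto
qed

lemma dyn_bounded:
  assumes "twice_differentiable (\<lambda>(u, x). dyn P u x)"
  shows "\<exists>M\<ge>0. \<forall>u x. (\<forall>j. G P u x $ j > 0) \<longrightarrow> norm (dyn P u x) \<le> M"
proof -
  obtain F' where "\<forall>z. ((\<lambda>(u, x). dyn P u x) has_derivative blinfun_apply (F' z)) (at z)"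
    using assms unfolding twice_differentiable_def by blast
  then have "continuous_on UNIV (\<lambda>(u, x). dyn P u x)"
    by (intro continuous_at_imp_continuous_on ballI) (rule has_derivative_continuous, blast)
  from bounded_on_feasible_box[OF this, of P] show ?thesis
    using G_pos_imp_feasible[of P] by fastforce
qed

text \<open>Bounds for the first derivatives of the dynamics, the state gradient of the Hamiltonian of
  stage \<open>i\<close> and its second derivatives at one point, up to a nonnegative diagonal matrix \<open>d\<close> in the
  input block, which stands for the barrier term. The Hamiltonian is affine in the costate; this
  explains the factor \<open>1 + norm lam\<close>.\<close>

definition stage_bound ::
    "('u::finite, 'x::finite) nmpc \<Rightarrow> nat \<Rightarrow> real \<Rightarrow> real^'u \<Rightarrow> real^'x \<Rightarrow> real^'x \<Rightarrow> bool" where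
  "stage_bound P i M u x lam \<longleftrightarrow>
    (\<forall>c a. \<bar>dyn_x P u x $ c $ a\<bar> \<le> M) \<and>
    (\<forall>c b. \<bar>dyn_u P u x $ c $ b\<bar> \<le> M) \<and>
    (\<forall>a. \<bar>ham_x P i u x lam $ a\<bar> \<le> M * (1 + norm lam)) \<and>
    (\<forall>b a. \<bar>jacobian (\<lambda>y. ham_u P i u y lam) (at x) $ b $ a\<bar> \<le> M * (1 + norm lam)) \<and>
    (\<forall>a a'. \<bar>jacobian (\<lambda>y. ham_x P i u y lam) (at x) $ a $ a'\<bar> \<le> M * (1 + norm lam)) \<and>
    (\<forall>a b. \<bar>jacobian (\<lambda>v. ham_x P i v x lam) (at u) $ a $ b\<bar> \<le> M * (1 + norm lam)) \<and>
    (\<exists>d. (\<forall>b. d b \<ge> 0) \<and> (\<forall>b b'. \<bar>jacobian (\<lambda>v. ham_u P i v x lam) (at u) $ b $ b'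
        - (if b = b' then d b else 0)\<bar> \<le> M * (1 + norm lam)))"

text \<open>By compactness of the boxes, one constant serves for all strictly feasible points whose state
  keeps a distance \<open>\<delta>\<close> from the boundary of the state box. No such margin is required of the input.\<close>

lemma stage_bounds:
  fixes P :: "('u::finite, 'x::finite) nmpc"
  assumes bar: "bar_par P \<ge> 0"
    and f: "twice_continuously_differentiable (\<lambda>(u, x). dyn P u x)"
    and l: "twice_continuously_differentiable (\<lambda>(u, x). cost P i u x)"
    and \<delta>: "\<delta> > 0"
  shows "\<exists>M\<ge>0. \<forall>u x lam. (\<forall>j. G P u x $ j > 0) \<longrightarrow> (\<forall>k. G P u x $ Inr k \<ge> \<delta>) \<longrightarrow>
    stage_bound P i M u x lam"
proof -
  obtain F F2 where F: "\<forall>z. ((\<lambda>(u, x). dyn P u x) has_derivative blinfun_apply (F z)) (at z)"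
    and F2: "\<forall>z. (F has_derivative blinfun_apply (F2 z)) (at z)"
    and F2c: "continuous_on UNIV F2"
    using f unfolding twice_continuously_differentiable_def by blast
  obtain C C2 where C: "\<forall>z. ((\<lambda>(u, x). cost P i u x) has_derivative blinfun_apply (C z)) (at z)"
    and C2: "\<forall>z. (C has_derivative blinfun_apply (C2 z)) (at z)"
    and C2c: "continuous_on UNIV C2"
    using l unfolding twice_continuously_differentiable_def by blast
  have Fc: "continuous_on UNIV F"
    using F2 by (intro continuous_at_imp_continuous_on ballI) (rule has_derivative_continuous, blast)
  have Cc: "continuous_on UNIV C"
    using C2 by (intro continuous_at_imp_continuous_on ballI) (rule has_derivative_continuous, blast)
  obtain MF where MF: "MF \<ge> 0" "\<forall>z\<in>feasible_box P. norm (F z) \<le> MF"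
    using bounded_on_feasible_box[OF Fc, of P] by (elim exE conjE)
  obtain MC where MC: "MC \<ge> 0" "\<forall>z\<in>feasible_box P. norm (C z) \<le> MC"
    using bounded_on_feasible_box[OF Cc, of P] by (elim exE conjE)
  obtain MF2 where MF2: "MF2 \<ge> 0" "\<forall>z\<in>feasible_box P. norm (F2 z) \<le> MF2"
    using bounded_on_feasible_box[OF F2c, of P] by (elim exE conjE)
  obtain MC2 where MC2: "MC2 \<ge> 0" "\<forall>z\<in>feasible_box P. norm (C2 z) \<le> MC2"
    using bounded_on_feasible_box[OF C2c, of P] by (elim exE conjE)
  define MB1 where "MB1 = bar_par P * (CARD(('u + 'u) + ('x + 'x)) * (1 / \<delta>))"
  define MB2 where "MB2 = bar_par P * (CARD(('u + 'u) + ('x + 'x)) * (1 / \<delta>\<^sup>2))"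
  have MB: "MB1 \<ge> 0" "MB2 \<ge> 0" using bar \<delta> by (simp_all add: MB1_def MB2_def)
  define M where "M = MF + MC + MF2 + MC2 + MB1 + MB2"
  have "M \<ge> 0" using MF(1) MC(1) MF2(1) MC2(1) MB by (simp add: M_def)
  have main: "stage_bound P i M u x lam"
    if pos: "\<forall>j. G P u x $ j > 0" and marg: "\<forall>k. G P u x $ Inr k \<ge> \<delta>" for u x lam
  proof -
    have z: "(u, x) \<in> feasible_box P" using pos by (rule G_pos_imp_feasible)
    let ?W = "{w :: (real^'u) \<times> (real^'x). norm w = 1}"
    have ax: "(axis b 1, 0) \<in> ?W" "(0, axis a 1) \<in> ?W" for a b by (simp_all add: norm_Pair)
    have lin: "norm (blinfun_apply H w) \<le> K" if "norm H \<le> K" "w \<in> ?W"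
      for H :: "((real^'u) \<times> (real^'x)) \<Rightarrow>\<^sub>L 'c::real_normed_vector" and w K
      using norm_blinfun[of H w] that by simp
    have quad: "norm (blinfun_apply (blinfun_apply H w') w) \<le> K"
      if "norm H \<le> K" "w \<in> ?W" "w' \<in> ?W"
      for H :: "((real^'u) \<times> (real^'x)) \<Rightarrow>\<^sub>L ((real^'u) \<times> (real^'x)) \<Rightarrow>\<^sub>L 'c::real_normed_vector" and w w' K
      using that by (intro lin) auto
    note MF = MF(1) MF(2)[rule_format, OF z] and MC = MC(1) MC(2)[rule_format, OF z]
      and MF2 = MF2(1) MF2(2)[rule_format, OF z] and MC2 = MC2(1) MC2(2)[rule_format, OF z]
    have le: "X + norm lam * Y \<le> M * (1 + norm lam)" if "X \<le> M" "Y \<le> M" for X Y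
      using that mult_left_mono[OF that(2), of "norm lam"] by (simp add: algebra_simps)
    have inner_le: "\<bar>lam \<bullet> q\<bar> \<le> norm lam * K" if "norm q \<le> K" for q K
      using Cauchy_Schwarz_ineq2[of lam q] mult_left_mono[OF that, of "norm lam"] by simp
    \<comment> \<open>\<open>B\<close> is the part of the barrier term that is kept: all of it in the state block, \<open>0\<close> elsewhere.\<close>
    have hess: "\<bar>ham_hess P C2 F2 (u, x) lam w w' - (barrier_hess P (u, x) w w' - B)\<bar>
        \<le> M * (1 + norm lam)"
      if w: "w \<in> ?W" "w' \<in> ?W" and B: "\<bar>B\<bar> \<le> MB2" for w w' B
    proof -
      have "\<bar>blinfun_apply (blinfun_apply (C2 (u, x)) w') w\<bar> \<le> MC2"
        using quad[OF MC2(2) w] by simp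
      moreover have "\<bar>lam \<bullet> blinfun_apply (blinfun_apply (F2 (u, x)) w') w\<bar> \<le> norm lam * MF2"
        by (rule inner_le[OF quad[OF MF2(2) w]])
      moreover have "MC2 + MB2 + norm lam * MF2 \<le> M * (1 + norm lam)"
        using MF(1) MC(1) MF2(1) MC2(1) MB by (intro le) (simp_all add: M_def)
      ultimately show ?thesis unfolding ham_hess_def using B by linarith
    qed
    note second = ham_second_derivatives[OF F C F2 C2 pos]
    have "MF \<le> M" using MC(1) MF2(1) MC2(1) MB by (simp add: M_def)
    have 1: "\<bar>dyn_x P u x $ c $ a\<bar> \<le> M" for c a
      unfolding dyn_partials[OF F]
      by (rule order_trans[OF component_le_norm_cart order_trans[OF lin[OF MF(2) ax(2)] \<open>MF \<le> M\<close>]])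
    have 2: "\<bar>dyn_u P u x $ c $ b\<bar> \<le> M" for c b
      unfolding dyn_partials[OF F]
      by (rule order_trans[OF component_le_norm_cart order_trans[OF lin[OF MF(2) ax(1)] \<open>MF \<le> M\<close>]])
    have 3: "\<bar>ham_x P i u x lam $ a\<bar> \<le> M * (1 + norm lam)" for a
    proof -
      have "\<bar>blinfun_apply (C (u, x)) (0, axis a 1)\<bar> \<le> MC"
        using lin[OF MC(2) ax(2)[of a]] by simp
      moreover have "\<bar>lam \<bullet> blinfun_apply (F (u, x)) (0, axis a 1)\<bar> \<le> norm lam * MF"
        by (rule inner_le[OF lin[OF MF(2) ax(2)]])
      moreover have "\<bar>bar_par P * (\<Sum>j\<in>UNIV. G_lin (0, axis a 1) $ j / G P u x $ j)\<bar> \<le> MB1"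
        unfolding MB1_def using marg by (intro barrier_grad_x_le[OF bar \<delta>]) auto
      moreover have "MC + MB1 + norm lam * MF \<le> M * (1 + norm lam)"
        using MF(1) MC(1) MF2(1) MC2(1) MB by (intro le) (simp_all add: M_def)
      ultimately show ?thesis
        unfolding ham_x_component[OF F C pos] ham_dir_def fst_conv snd_conv by linarith
    qed
    have 4: "\<bar>jacobian (\<lambda>y. ham_u P i u y lam) (at x) $ b $ a\<bar> \<le> M * (1 + norm lam)" for b a
      using hess[OF ax(1)[of b] ax(2)[of a], of 0] MB(2) unfolding second barrier_hess_mixed by simp
    have 5: "\<bar>jacobian (\<lambda>y. ham_x P i u y lam) (at x) $ a $ a'\<bar> \<le> M * (1 + norm lam)" for a a'
      using hess[OF ax(2)[of a] ax(2)[of a'] barrier_hess_xx_le[OF bar \<delta>, of "(u, x)" a a', folded MB2_def]]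
        marg unfolding second by simp
    have 6: "\<bar>jacobian (\<lambda>v. ham_x P i v x lam) (at u) $ a $ b\<bar> \<le> M * (1 + norm lam)" for a b
      using hess[OF ax(2)[of a] ax(1)[of b], of 0] MB(2) unfolding second barrier_hess_mixed by simp
    have 7: "\<bar>jacobian (\<lambda>v. ham_u P i v x lam) (at u) $ b $ b'
        - (if b = b' then barrier_hess P (u, x) (axis b 1, 0) (axis b 1, 0) else 0)\<bar>
      \<le> M * (1 + norm lam)" for b b'
      using hess[OF ax(1)[of b] ax(1)[of b'], of 0] MB(2) barrier_hess_uu_off_diag[of b b' P "(u, x)"]
      unfolding second by (cases "b = b'") simp_all
    show ?thesis
      unfolding stage_bound_def
      by (intro conjI allI 1 2 3 4 5 6 exI[of _ "\<lambda>b. barrier_hess P (u, x) (axis b 1, 0) (axis b 1, 0)"]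
          7 barrier_hess_nonneg[OF bar])
  qed
  show ?thesis
  proof (rule exI[of _ M], rule conjI[OF \<open>M \<ge> 0\<close>], intro allI impI)
    fix u x lam
    assume "\<forall>j. G P u x $ j > 0" "\<forall>k. G P u x $ Inr k \<ge> \<delta>"
    then show "stage_bound P i M u x lam" by (rule main)
  qed
qed

section \<open>Solutions of the KKT equations on a short horizon\<close>

lemma stack3_eq_0: "stack3 x u lam = 0 \<longleftrightarrow> x = 0 \<and> u = 0 \<and> lam = 0"
proof
  assume eq: "stack3 x u lam = 0"
  have "x $ a = 0" "u $ b = 0" "lam $ a = 0" for a b
    using arg_cong[OF eq, of "\<lambda>s. s $ Inl a"] arg_cong[OF eq, of "\<lambda>s. s $ Inr (Inl b)"]
      arg_cong[OF eq, of "\<lambda>s. s $ Inr (Inr a)"] by (simp_all add: stack3_def)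
  then show "x = 0 \<and> u = 0 \<and> lam = 0" by (simp add: vec_eq_iff)
next
  assume "x = 0 \<and> u = 0 \<and> lam = 0"
  then show "stack3 x u lam = 0" by (simp add: stack3_def vec_eq_iff split: sum.splits)
qed

lemma kkt_solution_equations:
  assumes "kkt_solution P N h S" and "i \<in> {1..N}"
  shows "x_of (S i) = x_prev P S i + h *\<^sub>R dyn P (u_of (S i)) (x_of (S i))"
    and "lam_of (S i)
      = lam_next N S i + h *\<^sub>R ham_x P i (u_of (S i)) (x_of (S i)) (lam_of (S i))"
    and "\<forall>j. G P (u_of (S i)) (x_of (S i)) $ j > 0"
  using assms unfolding kkt_solution_def kkt_def Let_def stack3_eq_0
  by (auto simp: algebra_simps)

lemma state_drift:
  assumes sol: "kkt_solution P N h S" and "h \<ge> 0"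
    and dyn: "\<And>u x. (\<forall>j. G P u x $ j > 0) \<Longrightarrow> norm (dyn P u x) \<le> M"
    and "i \<in> {1..N}"
  shows "norm (x_of (S i) - x_init P) \<le> real i * (h * M)"
  using \<open>i \<in> {1..N}\<close>
proof (induction i)
  case (Suc i)
  have step: "norm (h *\<^sub>R dyn P (u_of (S (Suc i))) (x_of (S (Suc i)))) \<le> h * M"
    using dyn[OF kkt_solution_equations(3)[OF sol Suc.prems]] \<open>h \<ge> 0\<close> by (simp add: mult_left_mono)
  have prev: "norm (x_prev P S (Suc i) - x_init P) \<le> real i * (h * M)"
    using Suc by (cases "i = 0") (auto simp: x_prev_def)
  have "x_of (S (Suc i)) - x_init P
      = (x_prev P S (Suc i) - x_init P) + h *\<^sub>R dyn P (u_of (S (Suc i))) (x_of (S (Suc i)))"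
    by (subst kkt_solution_equations(1)[OF sol Suc.prems]) simp
  also have "norm \<dots> \<le> real i * (h * M) + h * M"
    by (rule norm_triangle_le[OF add_mono[OF prev step]])
  finally show ?case by (simp add: algebra_simps)
qed simp

text \<open>A discrete Gronwall argument backwards in time, from the terminal value zero: if the step is
  small, each stage adds at most \<open>1 / N\<close> to the norm of the costate.\<close>

lemma costate_le_1:
  fixes P :: "('u::finite, 'x::finite) nmpc" and h M :: real
  assumes sol: "kkt_solution P N h S" and "h \<ge> 0" and "M \<ge> 0"
    and grad: "\<And>i a. i \<in> {1..N} \<Longrightarrow>
      \<bar>ham_x P i (u_of (S i)) (x_of (S i)) (lam_of (S i)) $ a\<bar> \<le> M * (1 + norm (lam_of (S i)))"
    and small: "3 * real N * (h * (CARD('x) * M)) \<le> 1"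
    and "i \<in> {1..N}"
  shows "norm (lam_of (S i)) \<le> 1"
proof -
  define K where "K = h * (CARD('x) * M)"
  have "K \<ge> 0" using \<open>h \<ge> 0\<close> \<open>M \<ge> 0\<close> by (simp add: K_def)
  have "N > 0" using \<open>i \<in> {1..N}\<close> by auto
  then have "3 * K \<le> 1 / real N" using small by (simp add: K_def field_simps)
  moreover have "1 / real N \<le> 1" using \<open>N > 0\<close> by simp
  ultimately have K3: "3 * K \<le> 1" by linarith
  have step: "norm (lam_of (S i)) \<le> z + 1 / real N"
    if i: "i \<in> {1..N}" and z: "norm (lam_next N S i) \<le> z" "z \<le> 1" for i z
  proof -
    let ?y = "norm (lam_of (S i))"
    let ?g = "ham_x P i (u_of (S i)) (x_of (S i)) (lam_of (S i))"
    have "norm ?g \<le> (\<Sum>a\<in>UNIV. \<bar>?g $ a\<bar>)" by (rule norm_le_l1_cart)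
    also have "\<dots> \<le> (\<Sum>a\<in>(UNIV :: 'x set). M * (1 + ?y))"
      by (intro sum_mono grad i)
    finally have "h * norm ?g \<le> h * (CARD('x) * (M * (1 + ?y)))"
      using \<open>h \<ge> 0\<close> by (intro mult_left_mono) auto
    then have "norm (h *\<^sub>R ?g) \<le> K * (1 + ?y)"
      using \<open>h \<ge> 0\<close> by (simp add: K_def mult_ac)
    moreover have "?y \<le> norm (lam_next N S i) + norm (h *\<^sub>R ?g)"
      by (subst (1) kkt_solution_equations(2)[OF sol i]) (rule norm_triangle_ineq)
    ultimately have "?y * (1 - K) \<le> z + K" using z by (simp add: algebra_simps)
    moreover have "z + K \<le> (z + 3 * K) * (1 - K)"
    proof -
      have "K * z \<le> K * 1" "K * (3 * K) \<le> K * 1"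
        using \<open>K \<ge> 0\<close> z K3 by (intro mult_left_mono; simp)+
      then show ?thesis by (simp add: algebra_simps)
    qed
    ultimately have "?y * (1 - K) \<le> (z + 3 * K) * (1 - K)" by linarith
    then have "?y \<le> z + 3 * K" using K3 \<open>K \<ge> 0\<close> by (subst (asm) mult_le_cancel_right) auto
    then show ?thesis using \<open>3 * K \<le> 1 / real N\<close> by linarith
  qed
  have "norm (lam_of (S (N - k))) \<le> real (Suc k) / real N" if "k < N" for k
    using that
  proof (induction k)
    case 0
    then show ?case using step[of N 0] by (simp add: lam_next_def)
  next
    case (Suc k)
    have "norm (lam_next N S (N - Suc k)) \<le> real (Suc k) / real N"
      using Suc by (simp add: lam_next_def Suc_diff_Suc)
    moreover have "N - Suc k \<in> {1..N}" "real (Suc k) / real N \<le> 1"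
      using Suc.prems by (auto simp: divide_le_eq)
    ultimately show ?case using step[of "N - Suc k" "real (Suc k) / real N"]
      by (simp add: add_divide_distrib)
  qed
  from this[of "N - i"] \<open>i \<in> {1..N}\<close> have "norm (lam_of (S i)) \<le> real (Suc (N - i)) / real N"
    by simp
  also have "\<dots> \<le> 1" using \<open>i \<in> {1..N}\<close> by (simp add: divide_le_eq)
  finally show ?thesis .
qed

lemma interior_margin:
  fixes l r x :: "real^'x::finite"
  assumes "x \<in> box l r"
  obtains \<delta> where "\<delta> > 0" and "\<And>a. l $ a + 2 * \<delta> \<le> x $ a" and "\<And>a. x $ a + 2 * \<delta> \<le> r $ a"
proof -
  define m where "m = Min (range (\<lambda>a. min (x $ a - l $ a) (r $ a - x $ a)))"
  have "m \<in> range (\<lambda>a. min (x $ a - l $ a) (r $ a - x $ a))" unfolding m_def by (intro Min_in) auto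
  then have "m > 0" using assms by (auto simp: mem_box_cart)
  moreover have "m \<le> min (x $ a - l $ a) (r $ a - x $ a)" for a
    unfolding m_def by (intro Min_le) auto
  then have "l $ a + 2 * (m / 2) \<le> x $ a" "x $ a + 2 * (m / 2) \<le> r $ a" for a
    by (simp_all add: le_diff_eq add.commute)
  ultimately show ?thesis using that[of "m / 2"] by simp
qed

text \<open>Since the step \<open>h\<close> multiplies every derivative, the diagonal block of a stage differs from a
  diagonal matrix by \<open>O(h)\<close>, once the barrier term \<open>h * d b\<close> of the input block is counted as part of
  the diagonal.\<close>

lemma stage_jacobian_near_diag:
  fixes P :: "('u::finite, 'x::finite) nmpc"
  assumes f: "twice_differentiable (\<lambda>(u, x). dyn P u x)"
    and l: "twice_differentiable (\<lambda>(u, x). cost P i u x)"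
    and pos: "\<forall>j. G P (u_of (S i)) (x_of (S i)) $ j > 0"
    and uxl: "u = u_of (S i)" "x = x_of (S i)" "lam = lam_of (S i)"
    and "h \<ge> 0" "M \<ge> 0"
    and fx: "\<forall>c a. \<bar>dyn_x P u x $ c $ a\<bar> \<le> M" and fu: "\<forall>c b. \<bar>dyn_u P u x $ c $ b\<bar> \<le> M"
    and ux: "\<forall>b a. \<bar>jacobian (\<lambda>y. ham_u P i u y lam) (at x) $ b $ a\<bar> \<le> 2 * M"
    and xx: "\<forall>a a'. \<bar>jacobian (\<lambda>y. ham_x P i u y lam) (at x) $ a $ a'\<bar> \<le> 2 * M"
    and xu: "\<forall>a b. \<bar>jacobian (\<lambda>v. ham_x P i v x lam) (at u) $ a $ b\<bar> \<le> 2 * M"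
    and uu: "\<forall>b b'. \<bar>jacobian (\<lambda>v. ham_u P i v x lam) (at u) $ b $ b'
        - (if b = b' then d b else 0)\<bar> \<le> 2 * M"
  shows "\<bar>D_block P N h S i $ p $ q - (if p = q then
      (case p of Inl a \<Rightarrow> -1 | Inr (Inl b) \<Rightarrow> reg_par P + h * d b | Inr (Inr c) \<Rightarrow> -1) else 0)\<bar>
    \<le> h * (2 * M)"
proof -
  have h1: "\<bar>h * y\<bar> \<le> h * (2 * M)" if "\<bar>y\<bar> \<le> 2 * M" for y
    using that \<open>h \<ge> 0\<close> by (simp add: abs_mult mult_left_mono)
  have h2: "\<bar>h * y\<bar> \<le> h * (2 * M)" if "\<bar>y\<bar> \<le> M" for y
    using that \<open>M \<ge> 0\<close> by (intro h1) linarith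
  have "0 \<le> h * (2 * M)" using \<open>h \<ge> 0\<close> \<open>M \<ge> 0\<close> by simp
  have uu1: "\<bar>h * jacobian (\<lambda>v. ham_u P i v x lam) (at u) $ b $ b - h * d b\<bar> \<le> h * (2 * M)" for b
    using h1[OF uu[rule_format, of b b]] by (simp add: right_diff_distrib)
  have uu2: "\<bar>h * jacobian (\<lambda>v. ham_u P i v x lam) (at u) $ b $ b'\<bar> \<le> h * (2 * M)" if "b \<noteq> b'" for b b'
    using h1[OF uu[rule_format, of b b']] that by simp
  show ?thesis
    unfolding kkt_jacobian[of P i S N h, OF f l pos] Dbar_block_def Dtilde_block_def Let_def uxl[symmetric]
    using fx fu ux xx xu \<open>0 \<le> h * (2 * M)\<close>
    by (cases p rule: block_cases; cases q rule: block_cases)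
      (simp_all add: block3_nth mat_def transpose_def h1 h2 uu1 uu2)
qed

lemma stage_bound_mono:
  assumes "stage_bound P i M u x lam" and "M \<le> M'"
  shows "stage_bound P i M' u x lam"
proof -
  have "M * (1 + norm lam) \<le> M' * (1 + norm lam)"
    using assms(2) by (intro mult_right_mono) auto
  then show ?thesis
    using assms unfolding stage_bound_def by (meson order_trans)
qed

text \<open>On a short horizon the states stay near the initial state, which is interior to the state box,
  so the bounds of \<open>stage_bounds\<close> hold with one margin for all solutions. The inputs may approach the
  boundary of their box, but this only increases the diagonal of the input block.\<close>

lemma short_horizon_regular:
  fixes P :: "('u::finite, 'x::finite) nmpc"
  assumes reg: "reg_par P > 0" and bar: "bar_par P \<ge> 0"
    and init: "x_init P \<in> box (x_lo P) (x_up P)"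
    and f: "twice_continuously_differentiable (\<lambda>(u, x). dyn P u x)"
    and l: "\<forall>i\<in>{1..CARD('n::{finite,linorder})}.
      twice_continuously_differentiable (\<lambda>(u, x). cost P i u x)"
  shows "\<exists>h0>0. \<forall>h S. 0 < h \<longrightarrow> h < h0 \<longrightarrow> kkt_solution P CARD('n) h S \<longrightarrow>
    pencil_regular (D_star P h S :: real^('n \<times> ('x + 'u + 'x))^('n \<times> ('x + 'u + 'x)))
      (L_mat + U_mat)"
proof -
  let ?N = "CARD('n)" and ?m = "CARD('x + 'u + 'x)"
  note f' = twice_continuously_differentiable_imp_twice_differentiable[OF f]
  obtain Mf where "Mf \<ge> 0" and Mf: "\<And>u x. (\<forall>j. G P u x $ j > 0) \<Longrightarrow> norm (dyn P u x) \<le> Mf"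
    using dyn_bounded[OF f'] by blast
  obtain \<delta> where "\<delta> > 0" and lo: "\<And>a. x_lo P $ a + 2 * \<delta> \<le> x_init P $ a"
    and up: "\<And>a. x_init P $ a + 2 * \<delta> \<le> x_up P $ a"
    using interior_margin[OF init] by blast
  have "\<forall>i\<in>{1..?N}. \<exists>M. M \<ge> 0 \<and> (\<forall>u x lam. (\<forall>j. G P u x $ j > 0) \<longrightarrow>
      (\<forall>k. G P u x $ Inr k \<ge> \<delta>) \<longrightarrow> stage_bound P i M u x lam)"
    using stage_bounds[OF bar f _ \<open>\<delta> > 0\<close>] l by blast
  from bchoice[OF this] obtain Ms where Ms: "\<And>i. i \<in> {1..?N} \<Longrightarrow> Ms i \<ge> 0"
    "\<And>i u x lam. i \<in> {1..?N} \<Longrightarrow> \<forall>j. G P u x $ j > 0 \<Longrightarrow> \<forall>k. G P u x $ Inr k \<ge> \<delta> \<Longrightarrow>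
      stage_bound P i (Ms i) u x lam"
    by blast
  define M where "M = (\<Sum>i\<in>{1..?N}. Ms i)"
  have "M \<ge> 0" unfolding M_def by (intro sum_nonneg Ms)
  have "Ms i \<le> M" if "i \<in> {1..?N}" for i
    unfolding M_def using that Ms(1) by (intro member_le_sum) auto
  then have B: "stage_bound P i M u x lam"
    if "i \<in> {1..?N}" "\<forall>j. G P u x $ j > 0" "\<forall>k. G P u x $ Inr k \<ge> \<delta>" for i u x lam
    using Ms(2)[OF that] stage_bound_mono that(1) by blast
  \<comment> \<open>\<open>h * Q1 < 1\<close> keeps the state margin \<open>\<delta>\<close>, \<open>h * Q2 < 1\<close> bounds the costates by \<open>1\<close>, and
    \<open>h * Q3 < 1\<close> and \<open>h * Q4 < 1\<close> are the two smallness conditions of the diagonal criterion.\<close>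
  define Q1 Q2 Q3 Q4 where
    "Q1 = real ?N * Mf / \<delta>" and "Q2 = 3 * real ?N * (CARD('x) * M)"
    and "Q3 = real ?N * (2 * M * ?m)" and "Q4 = 2 * M * ?m / reg_par P"
  have Q: "Q1 \<ge> 0" "Q2 \<ge> 0" "Q3 \<ge> 0" "Q4 \<ge> 0"
    using \<open>Mf \<ge> 0\<close> \<open>M \<ge> 0\<close> \<open>\<delta> > 0\<close> reg by (simp_all add: Q1_def Q2_def Q3_def Q4_def)
  define h0 where "h0 = 1 / (1 + Q1 + Q2 + Q3 + Q4)"
  have "h0 > 0" using Q by (simp add: h0_def add_pos_nonneg)
  moreover have "pencil_regular (D_star P h S :: real^('n \<times> ('x + 'u + 'x))^('n \<times> ('x + 'u + 'x)))
      (L_mat + U_mat)"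
    if "0 < h" "h < h0" and sol: "kkt_solution P ?N h S" for h S
  proof -
    have "h * (1 + Q1 + Q2 + Q3 + Q4) < 1"
      using \<open>h < h0\<close> Q unfolding h0_def by (simp add: less_divide_eq add_pos_nonneg)
    moreover have "h * Q1 \<ge> 0" "h * Q2 \<ge> 0" "h * Q3 \<ge> 0" "h * Q4 \<ge> 0" using \<open>0 < h\<close> Q by simp_all
    ultimately have hQ: "h * Q1 < 1" "h * Q2 < 1" "h * Q3 < 1" "h * Q4 < 1"
      using \<open>0 < h\<close> by (simp_all add: distrib_left)
    have marg: "G P (u_of (S i)) (x_of (S i)) $ Inr k \<ge> \<delta>" if "i \<in> {1..?N}" for i k
    proof -
      have "norm (x_of (S i) - x_init P) \<le> real i * (h * Mf)"
        using that \<open>0 < h\<close> by (intro state_drift[OF sol _ Mf]) auto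
      also have "\<dots> \<le> real ?N * (h * Mf)"
        using that \<open>0 < h\<close> \<open>Mf \<ge> 0\<close> by (intro mult_right_mono) auto
      also have "\<dots> = (h * Q1) * \<delta>" using \<open>\<delta> > 0\<close> by (simp add: Q1_def)
      also have "\<dots> \<le> 1 * \<delta>" using hQ(1) \<open>\<delta> > 0\<close> by (intro mult_right_mono) auto
      finally have "norm (x_of (S i) - x_init P) \<le> \<delta>" by simp
      then have d: "\<bar>x_of (S i) $ a - x_init P $ a\<bar> \<le> \<delta>" for a
        using component_le_norm_cart[of "x_of (S i) - x_init P" a] by simp
      show ?thesis
      proof (cases k)
        case (Inl a)
        with d[of a] lo[of a] show ?thesis by (simp add: G_def abs_le_iff)
      next
        case (Inr a)
        with d[of a] up[of a] show ?thesis by (simp add: G_def abs_le_iff)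
      qed
    qed
    note pos = kkt_solution_equations(3)[OF sol]
    have Bi: "stage_bound P i M (u_of (S i)) (x_of (S i)) (lam_of (S i))" if "i \<in> {1..?N}" for i
      using B[OF that pos[OF that]] marg[OF that] by blast
    have lam: "norm (lam_of (S i)) \<le> 1" if "i \<in> {1..?N}" for i
    proof (rule costate_le_1[OF sol _ \<open>M \<ge> 0\<close> _ _ that])
      show "3 * real ?N * (h * (CARD('x) * M)) \<le> 1"
        using hQ(2) by (simp add: Q2_def mult_ac)
    qed (use \<open>0 < h\<close> Bi in \<open>auto simp: stage_bound_def\<close>)
    have "\<exists>d. (\<forall>b. d b \<ge> 0) \<and> (\<forall>p q. \<bar>D_block P ?N h S i $ p $ q - (if p = q then
      (case p of Inl a \<Rightarrow> -1 | Inr (Inl b) \<Rightarrow> reg_par P + h * d b | Inr (Inr c) \<Rightarrow> -1) else 0)\<bar>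
      \<le> h * (2 * M))" if i: "i \<in> {1..?N}" for i
    proof -
      have le: "M * (1 + norm (lam_of (S i))) \<le> 2 * M"
        using mult_left_mono[of "1 + norm (lam_of (S i))" 2 M] lam[OF i] \<open>M \<ge> 0\<close> by simp
      note B = Bi[OF i]
      obtain d where d: "\<forall>b. d b \<ge> 0" "\<forall>b b'. \<bar>jacobian (\<lambda>v. ham_u P i v (x_of (S i)) (lam_of (S i)))
          (at (u_of (S i))) $ b $ b' - (if b = b' then d b else 0)\<bar> \<le> 2 * M"
        using B le unfolding stage_bound_def by (meson order_trans)
      have "twice_differentiable (\<lambda>(u, x). cost P i u x)"
        using l i twice_continuously_differentiable_imp_twice_differentiable by blast
      then have "\<bar>D_block P ?N h S i $ p $ q - (if p = q then
        (case p of Inl a \<Rightarrow> -1 | Inr (Inl b) \<Rightarrow> reg_par P + h * d b | Inr (Inr c) \<Rightarrow> -1) else 0)\<bar>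
        \<le> h * (2 * M)" for p q
        using \<open>0 < h\<close> \<open>M \<ge> 0\<close> pos[OF i] d(2) B[unfolded stage_bound_def]
        by (intro stage_jacobian_near_diag[OF f' _ _ refl refl refl])
          (simp | blast intro: order_trans[OF _ le])+
      with d(1) show ?thesis by blast
    qed
    then obtain d where d: "\<And>i b. i \<in> {1..?N} \<Longrightarrow> d i b \<ge> 0"
      "\<And>i p q. i \<in> {1..?N} \<Longrightarrow> \<bar>D_block P ?N h S i $ p $ q - (if p = q then
      (case p of Inl a \<Rightarrow> -1 | Inr (Inl b) \<Rightarrow> reg_par P + h * d i b | Inr (Inr c) \<Rightarrow> -1) else 0)\<bar>
      \<le> h * (2 * M)"
      by metis
    show ?thesis
      unfolding D_star_def
    proof (rule pencil_regular_diag_dominant[where e = "h * (2 * M)" and \<gamma> = "reg_par P"])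
      fix i :: 'n
      show "\<bar>D_block P ?N h S (stage i) $ p $ q - (if p = q then
        (case p of Inl a \<Rightarrow> -1 | Inr (Inl b) \<Rightarrow> reg_par P + h * d (stage i) b | Inr (Inr c) \<Rightarrow> -1)
        else 0)\<bar> \<le> h * (2 * M)" for p q
        by (rule d(2)[OF stage_range])
      show "reg_par P \<le> (case Inr (Inl b) of Inl a \<Rightarrow> -1
        | Inr (Inl b) \<Rightarrow> reg_par P + h * d (stage i) b | Inr (Inr c) \<Rightarrow> -1)" for b
        using d(1)[OF stage_range, of i b] \<open>0 < h\<close> by simp
      show "real ?N * (h * (2 * M) * ?m) < 1" using hQ(3) by (simp only: Q3_def mult_ac)
      show "h * (2 * M) * ?m < reg_par P"
      proof -
        have "h * (2 * M) * ?m = (h * Q4) * reg_par P" using reg by (simp add: Q4_def)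
        also have "\<dots> < 1 * reg_par P" using hQ(4) reg by (intro mult_strict_right_mono)
        finally show ?thesis by simp
      qed
    qed simp_all
  qed
  ultimately show ?thesis by blast
qed

section \<open>Convergence of the upper-layer Jacobi method\<close>

lemma perturbed_Dbar_regular:
  fixes A :: "'n::{finite,linorder} \<Rightarrow> real^('x::finite + 'u::finite + 'x)^('x + 'u + 'x)"
  assumes reg: "pencil_regular (block_diag A) K" and "h > 0"
  shows "\<exists>\<epsilon>>0. \<forall>B. (\<forall>i. norm (Dtilde_block (B i)) < \<epsilon> * norm (A i)) \<longrightarrow>
    pencil_regular (block_diag A + h *\<^sub>R Dtilde_star B) K"
proof -
  obtain c where "c > 0" and c: "\<And>E. (\<forall>p q. \<bar>E $ p $ q\<bar> < c) \<Longrightarrow> pencil_regular (block_diag A + E) K"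
    using pencil_regular_perturb[OF reg] by blast
  define a where "a = (\<Sum>i\<in>UNIV. norm (A i))"
  have a: "norm (A i) \<le> a" for i unfolding a_def by (intro member_le_sum) auto
  have "a \<ge> 0" unfolding a_def by (intro sum_nonneg) auto
  define \<epsilon> where "\<epsilon> = c / (h * (a + 1))"
  have "\<epsilon> > 0" using \<open>c > 0\<close> \<open>h > 0\<close> \<open>a \<ge> 0\<close> by (simp add: \<epsilon>_def)
  moreover have "pencil_regular (block_diag A + h *\<^sub>R Dtilde_star B) K"
    if B: "\<forall>i. norm (Dtilde_block (B i)) < \<epsilon> * norm (A i)" for B
  proof (rule c, intro allI)
    fix p q :: "'n \<times> ('x + 'u + 'x)"
    have entry: "\<bar>Dtilde_block (B (fst p)) $ snd p $ snd q\<bar> \<le> norm (Dtilde_block (B (fst p)))"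
      by (rule order_trans[OF component_le_norm_cart Finite_Cartesian_Product.norm_nth_le])
    have "\<bar>Dtilde_star B $ p $ q\<bar> \<le> norm (Dtilde_block (B (fst p)))"
      unfolding Dtilde_star_def block_diag_def using entry by (cases "fst p = fst q") simp_all
    also have "\<dots> < \<epsilon> * norm (A (fst p))" using B by blast
    also have "\<dots> \<le> \<epsilon> * (a + 1)"
      using a[of "fst p"] \<open>\<epsilon> > 0\<close> by (intro mult_left_mono) auto
    finally have "h * \<bar>Dtilde_star B $ p $ q\<bar> < h * (\<epsilon> * (a + 1))"
      using \<open>h > 0\<close> by (rule mult_strict_left_mono)
    also have "\<dots> = c" using \<open>h > 0\<close> \<open>a \<ge> 0\<close> by (simp add: \<epsilon>_def)
    finally show "\<bar>(h *\<^sub>R Dtilde_star B) $ p $ q\<bar> < c"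
      using \<open>h > 0\<close> by (simp add: abs_mult)
  qed
  ultimately show ?thesis by blast
qed

theorem theorem2:
  fixes P :: "('u::finite, 'x::finite) nmpc"
  assumes "reg_par P \<ge> 0" and "bar_par P > 0"
    and "twice_differentiable (\<lambda>(u, x). dyn P u x)"
    and "\<forall>i\<in>{1..CARD('n::{finite,linorder})}. twice_differentiable (\<lambda>(u, x). cost P i u x)"
  shows
    "(reg_par P \<noteq> 0 \<longrightarrow>
      x_init P \<in> box (x_lo P) (x_up P) \<longrightarrow>
      twice_continuously_differentiable (\<lambda>(u, x). dyn P u x) \<longrightarrow>
      (\<forall>i\<in>{1..CARD('n)}. twice_continuously_differentiable (\<lambda>(u, x). cost P i u x)) \<longrightarrow>
      (\<exists>T0>0. \<forall>T S. 0 < T \<longrightarrow> T < T0 \<longrightarrow>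
        kkt_solution P CARD('n) (T / real CARD('n)) S \<longrightarrow>
        (let D = (D_star P (T / real CARD('n)) S
                    :: real^('n \<times> ('x + 'u + 'x))^('n \<times> ('x + 'u + 'x)))
         in invertible D \<and> spectral_radius (matrix_inv D ** (L_mat + U_mat)) < 1)))
   \<and>
     (\<forall>T S. T > 0 \<longrightarrow>
        kkt_solution P CARD('n) (T / real CARD('n)) S \<longrightarrow>
        (\<forall>i\<in>{1..CARD('n)}. invertible (Dbar_block P (T / real CARD('n)) S i)) \<longrightarrow>
        (\<exists>\<epsilon>>0. \<forall>B :: 'n \<Rightarrow> real^'u^'x.
          (\<forall>i. norm (Dtilde_block (B i))
                 < \<epsilon> * norm (Dbar_block P (T / real CARD('n)) S (stage i))) \<longrightarrow>
          (let D = (Dbar_star P (T / real CARD('n)) S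
                      + (T / real CARD('n)) *\<^sub>R Dtilde_star B
                      :: real^('n \<times> ('x + 'u + 'x))^('n \<times> ('x + 'u + 'x)))
           in invertible D \<and> spectral_radius (matrix_inv D ** (L_mat + U_mat)) < 1)))"
proof (rule conjI, goal_cases)
  case 1
  show ?case
  proof (intro impI)
    assume reg: "reg_par P \<noteq> 0" and init: "x_init P \<in> box (x_lo P) (x_up P)"
      and f: "twice_continuously_differentiable (\<lambda>(u, x). dyn P u x)"
      and l: "\<forall>i\<in>{1..CARD('n)}. twice_continuously_differentiable (\<lambda>(u, x). cost P i u x)"
    obtain h0 where "h0 > 0" and h0: "\<And>h S. 0 < h \<Longrightarrow> h < h0 \<Longrightarrow> kkt_solution P CARD('n) h S \<Longrightarrow>
        pencil_regular (D_star P h S :: real^('n \<times> ('x + 'u + 'x))^('n \<times> ('x + 'u + 'x)))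
          (L_mat + U_mat)"
      using short_horizon_regular[OF _ _ init f l] reg assms(1,2) by fastforce
    show "\<exists>T0>0. \<forall>T S. 0 < T \<longrightarrow> T < T0 \<longrightarrow>
        kkt_solution P CARD('n) (T / real CARD('n)) S \<longrightarrow>
        (let D = (D_star P (T / real CARD('n)) S
                    :: real^('n \<times> ('x + 'u + 'x))^('n \<times> ('x + 'u + 'x)))
         in invertible D \<and> spectral_radius (matrix_inv D ** (L_mat + U_mat)) < 1)"
      unfolding Let_def
    proof (rule exI[of _ "real CARD('n) * h0"], rule conjI, goal_cases)
      case 1
      show ?case using \<open>h0 > 0\<close> by simp
    next
      case 2
      show ?case
        by (intro allI impI pencil_regular_imp_spectral_radius h0) (simp_all add: divide_less_eq mult.commute)
    qed
  qed
next
  case 2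
  show ?case
  proof (intro allI impI, goal_cases)
    case (1 T S)
    let ?h = "T / real CARD('n)"
    have "?h > 0" using 1(1) by simp
    let ?A = "\<lambda>i :: 'n. Dbar_block P ?h S (stage i)"
    have "pencil_regular (block_diag ?A) (L_mat + U_mat)"
    proof (rule pencil_regular_block_triangular)
      show "invertible (?A i)" for i using 1(3) stage_range[of i] by blast
    qed (simp_all add: Dbar_block_def Let_def block3_nth)
    from perturbed_Dbar_regular[OF this \<open>?h > 0\<close>]
    obtain \<epsilon> where "\<epsilon> > 0" and \<epsilon>: "\<And>B :: 'n \<Rightarrow> real^'u^'x.
        (\<forall>i. norm (Dtilde_block (B i)) < \<epsilon> * norm (?A i)) \<Longrightarrow>
        pencil_regular (block_diag ?A + ?h *\<^sub>R Dtilde_star B) (L_mat + U_mat)"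
      by blast
    show ?case
      unfolding Let_def Dbar_star_def
      by (rule exI[of _ \<epsilon>], rule conjI[OF \<open>\<epsilon> > 0\<close>],
          intro allI impI pencil_regular_imp_spectral_radius \<epsilon>) blast
  qed
qed

end
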